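(* Let an Adinkra with $N$ colors and vertex set $V$ be given, with boson–fermion matrix $X$ and signed Laplacian $L$. If $N$ is not a multiple of $4$, then the invariant factors of $X$ are $$(1^{\#V/4},\,N^{\#V/4}),$$ and the invariant factors of $L$ are $$(1^{\#V/2},\,(N(N-1))^{\#V/2}),$$ where exponents denote multiplicities.
   Context: A signed graph is a finite undirected simple graph $(V,E)$ with a signature $\mu:E\to\{-1,1\}$; edges with $\mu(e)=-1$ are called dashed, those with $\mu(e)=1$ solid. An Adinkra with $N\ge 1$ colors is a non-empty finite bipartite signed graph $(V,E,\mu)$ (with a fixed bipartition of $V$ into bosons and fermions, every edge joining a boson to a fermion), together with an assignment of one of $N$ colors to each edge and a function $h:V\to\mathbb{Z}$ (the function $h$ plays no role here), such that: (i) each vertex is incident to exactly $N$ edges, one of each color; (ii) for any two distinct colors, the subgraph consisting of all edges of those two colors is a disjoint union of $4$-cycles (called bicolor cycles); (iii) every bicolor cycle contains an odd number of dashed edges; (iv) $|h(v)-h(w)|=1$ for adjacent $v,w$. An Adinkra need not be connected; there are $\#V/2$ bosons and $\#V/2$ fermions. $X$ is the $\frac{\#V}{2}\times\frac{\#V}{2}$ integer matrix whose $(i,j)$ entry is $\mu(e)$ if there is an edge $e$ between the $i$th boson and $j$th fermion, and $0$ otherwise. With bosons ordered first, the signed Laplacian is $L=\begin{pmatrix}NI&-X\\-X^T&NI\end{pmatrix}$. The invariant factors of an integer square matrix are the nonnegative diagonal entries $d_1\mid d_2\mid\cdots$ of its Smith Normal Form over $\mathbb{Z}$, listed in this order with multiplicity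 (entries may be $0$).
   Formalization: For N = 1 the exponent #V/4 need not be an integer (a single edge has #V = 2), so in that case the invariant factors of X are stated as 1 with multiplicity #V/2; this agrees with the printed list whenever 4 divides #V. *)

theory Defs
  imports Jordan_Normal_Form.Matrix
begin

section \<open>Adinkras\<close>

text \<open>Undirected edges are two-element sets of vertices. Edges with sign \<open>-1\<close> are dashed.\<close>

locale signed_graph =
  fixes V :: "'v set" and E :: "'v set set" and \<mu> :: "'v set \<Rightarrow> int"
  assumes finite_vertices: "finite V"
    and simple: "e \<in> E \<Longrightarrow> e \<subseteq> V \<and> card e = 2"
    and signature: "e \<in> E \<Longrightarrow> \<mu> e \<in> {-1, 1}"

definition four_cycle :: "'v set set \<Rightarrow> bool" where
  "four_cycle C \<longleftrightarrow>
    (\<exists>a b c d. distinct [a, b, c, d] \<and> C = {{a, b}, {b, c}, {c, d}, {d, a}})"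

text \<open>Subgraphs without isolated vertices are represented by their edge sets, so the vertex
  set of \<open>C\<close> is \<open>\<Union>C\<close>.\<close>

definition disjoint_union_of_four_cycles :: "'v set set \<Rightarrow> bool" where
  "disjoint_union_of_four_cycles S \<longleftrightarrow>
    (\<exists>\<C>. (\<forall>C\<in>\<C>. four_cycle C) \<and> pairwise (\<lambda>C D. disjnt (\<Union>C) (\<Union>D)) \<C> \<and> S = \<Union>\<C>)"

definition bicolor_edges :: "'v set set \<Rightarrow> ('v set \<Rightarrow> nat) \<Rightarrow> nat \<Rightarrow> nat \<Rightarrow> 'v set set" where
  "bicolor_edges E color i j = {e \<in> E. color e = i \<or> color e = j}"

text \<open>When the edges of colors \<open>i\<close> and \<open>j\<close> form a disjoint union of four-cycles, the
  four-cycles contained in it are exactly its components. The colors are \<open>0, \<dots>, N - 1\<close>;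
  \<open>B\<close> and \<open>F\<close> are the bosons and the fermions.\<close>

locale adinkra = signed_graph V E \<mu>
  for V :: "'v set" and E :: "'v set set" and \<mu> :: "'v set \<Rightarrow> int" +
  fixes B F :: "'v set" and N :: nat and color :: "'v set \<Rightarrow> nat" and h :: "'v \<Rightarrow> int"
  assumes N_pos: "1 \<le> N"
    and nonempty: "V \<noteq> {}"
    and bipartition: "B \<union> F = V" "B \<inter> F = {}"
    and bipartite: "e \<in> E \<Longrightarrow> \<exists>b\<in>B. \<exists>f\<in>F. e = {b, f}"
    and color_range: "e \<in> E \<Longrightarrow> color e < N"
    and one_edge_of_each_color: "\<lbrakk>v \<in> V; c < N\<rbrakk> \<Longrightarrow> \<exists>!e. e \<in> E \<and> v \<in> e \<and> color e = c"
    and bicolor: "\<lbrakk>i < N; j < N; i \<noteq> j\<rbrakk> \<Longrightarrow>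
      disjoint_union_of_four_cycles (bicolor_edges E color i j)"
    and odd_dashed: "\<lbrakk>i < N; j < N; i \<noteq> j; four_cycle C; C \<subseteq> bicolor_edges E color i j\<rbrakk> \<Longrightarrow>
      odd (card {e \<in> C. \<mu> e = -1})"
    and height: "{v, w} \<in> E \<Longrightarrow> \<bar>h v - h w\<bar> = 1"

text \<open>The lists \<open>bs\<close> and \<open>fs\<close> enumerate the bosons and the fermions.\<close>

definition boson_fermion_mat ::
    "'v set set \<Rightarrow> ('v set \<Rightarrow> int) \<Rightarrow> 'v list \<Rightarrow> 'v list \<Rightarrow> int mat" where
  "boson_fermion_mat E \<mu> bs fs = mat (length bs) (length fs)
    (\<lambda>(i, j). if {bs ! i, fs ! j} \<in> E then \<mu> {bs ! i, fs ! j} else 0)"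

definition signed_laplacian :: "nat \<Rightarrow> int mat \<Rightarrow> int mat" where
  "signed_laplacian N X = four_block_mat
    (int N \<cdot>\<^sub>m 1\<^sub>m (dim_row X)) (- X)
    (- transpose_mat X) (int N \<cdot>\<^sub>m 1\<^sub>m (dim_col X))"


section \<open>Invariant factors\<close>

definition smith_normal_form_of :: "int mat \<Rightarrow> int mat \<Rightarrow> bool" where
  "smith_normal_form_of A S \<longleftrightarrow>
    (\<exists>n. A \<in> carrier_mat n n \<and> S \<in> carrier_mat n n \<and>
      diagonal_mat S \<and>
      (\<forall>i<n. 0 \<le> S $$ (i, i)) \<and>
      (\<forall>i. Suc i < n \<longrightarrow> S $$ (i, i) dvd S $$ (Suc i, Suc i)) \<and>
      (\<exists>P Q. P \<in> carrier_mat n n \<and> Q \<in> carrier_mat n n \<and>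
        invertible_mat P \<and> invertible_mat Q \<and> S = P * A * Q))"

text \<open>\<open>invertible_mat\<close> over \<open>int\<close> means unimodular. The Smith normal form is unique, so
  \<open>has_invariant_factors A ds\<close> determines \<open>ds\<close>.\<close>

definition has_invariant_factors :: "int mat \<Rightarrow> int list \<Rightarrow> bool" where
  "has_invariant_factors A ds \<longleftrightarrow> (\<exists>S. smith_normal_form_of A S \<and> diag_mat S = ds)"

text \<open>If \<open>ds\<close> are the invariant factors of \<open>A\<close> then \<open>A\<close> is square of size \<open>length ds\<close>. A
  claim \<open>has_invariant_factors A (replicate k x @ replicate k y)\<close> for a square matrix with
  \<open>card V div 2\<close> rows and \<open>k = card V div 4\<close> therefore includes that \<open>card V div 4\<close> does not
  round. For an adinkra with one color \<open>card V\<close> need only be even; there both listed values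
  of the invariant factors of the boson-fermion matrix are 1, so only their total number
  \<open>card V div 2\<close> matters.\<close>

end

theory Submission
  imports Defs Jordan_Normal_Form.Determinant "HOL-Computational_Algebra.Primes"
begin

text \<open>
The edges of one color \<open>c\<close> form a perfect matching, so they give a signed permutation matrix
\<open>X\<^sub>c\<close> from fermions to bosons, and \<open>X\<close> is the sum of the \<open>X\<^sub>c\<close>. The conditions on bicolor cycles
say that \<open>X\<^sub>c X\<^sub>d\<^sup>T = - X\<^sub>d X\<^sub>c\<^sup>T\<close> for distinct colors (\<open>nbr_anticommute\<close>, \<open>color_entry_clifford\<close>).
Summing these Clifford relations yields \<open>X X\<^sup>T = N\<close>, and \<open>X Y\<^sup>T + Y X\<^sup>T = 2\<close> for \<open>Y\<close> the matrix of a
single color (\<open>boson_fermion_mat_clifford\<close>). The rest of the argument is about integer matrices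
with these two properties.

Let \<open>S = P X Q\<close> be the Smith normal form, with diagonal entries \<open>d\<^sub>i\<close>. The first relation says
that \<open>Q\<^sup>-\<^sup>1 X\<^sup>T P\<^sup>-\<^sup>1\<close> is diagonal with entries \<open>N / d\<^sub>i\<close>. Reading the second relation on the diagonal
writes \<open>2\<close> as an integer combination of \<open>d\<^sub>i\<close> and \<open>N / d\<^sub>i\<close>. If \<open>4\<close> does not divide \<open>N\<close>, these two
numbers are therefore coprime. Since the square of the product of the \<open>d\<^sub>i\<close> is a power of \<open>N\<close> with
the size of \<open>X\<close> as exponent, every prime divisor of \<open>N\<close> divides exactly half of the \<open>d\<^sub>i\<close>; these
form the upper half of the divisibility chain, whence \<open>d\<^sub>i = 1\<close> in the lower half and \<open>d\<^sub>i = N\<close> in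
the upper half (\<open>unitary_divisor_chain_half\<close>, \<open>clifford_normal_form\<close>). For \<open>N = 1\<close> there are no such
primes and all \<open>d\<^sub>i\<close> are \<open>1\<close>.

For the Laplacian, the block-diagonal matrices with blocks \<open>P, Q\<^sup>-\<^sup>1\<close> on the left and \<open>P\<^sup>-\<^sup>1, Q\<close> on
the right replace the blocks \<open>X\<close> and \<open>X\<^sup>T\<close> by the two diagonal matrices above and leave the
scalar blocks alone (\<open>signed_laplacian_equiv\<close>). What remains is a direct sum of \<open>2\<close> by \<open>2\<close>
matrices with diagonal entries \<open>N\<close> and off-diagonal entries \<open>-1\<close> and \<open>-N\<close>. Each has a unit entry
and determinant \<open>N (N - 1)\<close>, so its invariant factors are \<open>1\<close> and \<open>N (N - 1)\<close>
(\<open>split_laplacian_normal_form\<close>).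
\<close>

section \<open>Unimodular equivalence of integer matrices\<close>

lemma invertible_matI:
  assumes "P \<in> carrier_mat n n" "P' \<in> carrier_mat n n" "P * P' = 1\<^sub>m n" "P' * P = 1\<^sub>m n"
  shows "invertible_mat P"
  using assms unfolding invertible_mat_def inverts_mat_def by auto

lemma invertible_matE:
  assumes "invertible_mat P" "P \<in> carrier_mat n n"
  obtains P' where "P' \<in> carrier_mat n n" "P * P' = 1\<^sub>m n" "P' * P = 1\<^sub>m n"
proof -
  obtain B where B: "P * B = 1\<^sub>m (dim_row P)" "B * P = 1\<^sub>m (dim_row B)"
    using assms unfolding invertible_mat_def inverts_mat_def by auto
  have "dim_col B = n" using arg_cong[OF B(1), of dim_col] assms by simp
  moreover have "dim_row B = n" using arg_cong[OF B(2), of dim_col] assms by simp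
  ultimately show thesis using that[of B] B assms(2) by auto
qed

lemma mult_inverse_cancel_left:
  fixes A :: "int mat"
  assumes "P \<in> carrier_mat n n" "P' \<in> carrier_mat n n" "P' * P = 1\<^sub>m n" "A \<in> carrier_mat n m"
  shows "P' * (P * A) = A"
  using assoc_mult_mat[OF assms(2,1,4)] assms(3,4) by simp

lemma invertible_mat_mult:
  fixes P :: "int mat"
  assumes "P \<in> carrier_mat n n" "Q \<in> carrier_mat n n" "invertible_mat P" "invertible_mat Q"
  shows "invertible_mat (P * Q)"
proof -
  obtain P' where P': "P' \<in> carrier_mat n n" "P * P' = 1\<^sub>m n" "P' * P = 1\<^sub>m n"
    using invertible_matE assms by metis
  obtain Q' where Q': "Q' \<in> carrier_mat n n" "Q * Q' = 1\<^sub>m n" "Q' * Q = 1\<^sub>m n"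
    using invertible_matE assms by metis
  show ?thesis
    by (rule invertible_matI[of _ n "Q' * P'"])
      (use assms P' Q' in \<open>simp_all add: assoc_mult_mat[of _ n n _ n _ n]
          mult_inverse_cancel_left[of _ n _ _ n]\<close>)
qed

lemma invertible_one_mat: "invertible_mat (1\<^sub>m n :: int mat)"
  by (rule invertible_matI[of _ n "1\<^sub>m n"]) auto

definition unimodular_equiv :: "nat \<Rightarrow> int mat \<Rightarrow> int mat \<Rightarrow> bool" where
  "unimodular_equiv n A B \<longleftrightarrow> A \<in> carrier_mat n n \<and>
    (\<exists>P Q. P \<in> carrier_mat n n \<and> Q \<in> carrier_mat n n \<and>
      invertible_mat P \<and> invertible_mat Q \<and> B = P * A * Q)"

lemma unimodular_equivI:
  assumes "A \<in> carrier_mat n n" "P \<in> carrier_mat n n" "Q \<in> carrier_mat n n"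
    "invertible_mat P" "invertible_mat Q" "B = P * A * Q"
  shows "unimodular_equiv n A B"
  using assms unfolding unimodular_equiv_def by blast

lemma unimodular_equiv_carrier:
  assumes "unimodular_equiv n A B"
  shows "A \<in> carrier_mat n n" "B \<in> carrier_mat n n"
  using assms unfolding unimodular_equiv_def by auto

lemma unimodular_equiv_refl: "A \<in> carrier_mat n n \<Longrightarrow> unimodular_equiv n A A"
  by (rule unimodular_equivI[of _ _ "1\<^sub>m n" "1\<^sub>m n"]) (auto simp: invertible_one_mat)

lemma unimodular_equiv_trans:
  assumes "unimodular_equiv n A B" "unimodular_equiv n B C"
  shows "unimodular_equiv n A C"
proof -
  obtain P Q where PQ: "P \<in> carrier_mat n n" "Q \<in> carrier_mat n n"
      "invertible_mat P" "invertible_mat Q" "B = P * A * Q" "A \<in> carrier_mat n n"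
    using assms(1) unfolding unimodular_equiv_def by blast
  obtain P' Q' where PQ': "P' \<in> carrier_mat n n" "Q' \<in> carrier_mat n n"
      "invertible_mat P'" "invertible_mat Q'" "C = P' * B * Q'"
    using assms(2) unfolding unimodular_equiv_def by blast
  show ?thesis
    by (rule unimodular_equivI[of _ _ "P' * P" "Q * Q'"])
      (use PQ PQ' in \<open>auto simp: assoc_mult_mat[of _ n n _ n _ n] intro: invertible_mat_mult\<close>)
qed

lemma unimodular_equiv_left:
  assumes "A \<in> carrier_mat n n" "P \<in> carrier_mat n n" "invertible_mat P"
  shows "unimodular_equiv n A (P * A)"
  by (rule unimodular_equivI[of _ _ P "1\<^sub>m n"]) (use assms in \<open>auto simp: invertible_one_mat\<close>)

lemma invertible_transpose_mat:
  fixes P :: "int mat"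
  assumes "P \<in> carrier_mat n n" "invertible_mat P"
  shows "invertible_mat (transpose_mat P)"
proof -
  obtain P' where P': "P' \<in> carrier_mat n n" "P * P' = 1\<^sub>m n" "P' * P = 1\<^sub>m n"
    using invertible_matE assms by metis
  have "P\<^sup>T * P'\<^sup>T = 1\<^sub>m n" "P'\<^sup>T * P\<^sup>T = 1\<^sub>m n"
    using arg_cong[OF P'(2), of transpose_mat] arg_cong[OF P'(3), of transpose_mat]
      transpose_mult[OF assms(1) P'(1)] transpose_mult[OF P'(1) assms(1)] by auto
  then show ?thesis using assms P' by (intro invertible_matI[of _ n "P'\<^sup>T"]) auto
qed

lemma unimodular_equiv_transpose:
  assumes "unimodular_equiv n A B"
  shows "unimodular_equiv n A\<^sup>T B\<^sup>T"
proof -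
  obtain P Q where PQ: "P \<in> carrier_mat n n" "Q \<in> carrier_mat n n"
      "invertible_mat P" "invertible_mat Q" "B = P * A * Q" and A: "A \<in> carrier_mat n n"
    using assms unfolding unimodular_equiv_def by blast
  have "B\<^sup>T = Q\<^sup>T * A\<^sup>T * P\<^sup>T"
    using PQ A by (simp add: transpose_mult[of _ n n _ n] assoc_mult_mat[of _ n n _ n _ n])
  then show ?thesis
    using PQ A by (intro unimodular_equivI[of _ _ "Q\<^sup>T" "P\<^sup>T"]) (auto intro: invertible_transpose_mat)
qed

lemma unimodular_equiv_addrow:
  assumes "A \<in> carrier_mat n n" "k < n" "l < n" "k \<noteq> l"
  shows "unimodular_equiv n A (addrow a k l A)"
proof -
  have "invertible_mat (addrow_mat n a k l)"
    by (rule invertible_matI[of _ n "addrow_mat n (- a) k l"])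
      (use assms addrow_mat_inv[of k n l a] addrow_mat_inv[of k n l "- a"] in auto)
  then show ?thesis
    using unimodular_equiv_left[of A n "addrow_mat n a k l"] assms addrow_mat[of A n n l a k] by auto
qed

lemma unimodular_equiv_swaprows:
  assumes "A \<in> carrier_mat n n" "k < n" "l < n"
  shows "unimodular_equiv n A (swaprows k l A)"
proof -
  have "invertible_mat (swaprows_mat n k l :: int mat)"
    by (rule invertible_matI[of _ n "swaprows_mat n k l"]) (use assms swaprows_mat_inv[of k n l] in auto)
  then show ?thesis
    using unimodular_equiv_left[of A n "swaprows_mat n k l"] assms swaprows_mat[of A n n k l] by auto
qed

lemma unimodular_equiv_move_to_corner:
  assumes A: "A \<in> carrier_mat n n" and ij: "i < n" "j < n"
  obtains B where "unimodular_equiv n A B" "B $$ (0, 0) = A $$ (i, j)"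
proof -
  define A1 where "A1 = (swaprows 0 i A)\<^sup>T"
  define B where "B = (swaprows 0 j A1)\<^sup>T"
  have A1: "A1 \<in> carrier_mat n n" using A unfolding A1_def by auto
  have "unimodular_equiv n A\<^sup>T\<^sup>T A1\<^sup>T"
    unfolding A1_def using A ij by (auto intro: unimodular_equiv_swaprows)
  moreover have "unimodular_equiv n A1\<^sup>T B"
    unfolding B_def using A1 ij by (auto intro!: unimodular_equiv_transpose unimodular_equiv_swaprows)
  ultimately have "unimodular_equiv n A B" using unimodular_equiv_trans by auto
  moreover have "B $$ (0, 0) = A $$ (i, j)"
    unfolding B_def A1_def using A ij by auto
  ultimately show thesis using that by blast
qed

lemma unimodular_equiv_uminus:
  assumes "A \<in> carrier_mat n n"
  shows "unimodular_equiv n A (- A)"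
proof -
  have "invertible_mat (- 1\<^sub>m n :: int mat)"
    by (rule invertible_matI[of _ n "- 1\<^sub>m n"]) auto
  then show ?thesis using unimodular_equiv_left[of A n "- 1\<^sub>m n"] assms by auto
qed

text \<open>Schur complement: once the corner entry divides its row and its column, multiplying by a
unipotent block matrix on either side subtracts the right multiples of the first row and column,
and no division outside the integers occurs.\<close>

lemma clear_first_row_and_column:
  fixes A :: "int mat"
  assumes A: "A \<in> carrier_mat (Suc n) (Suc n)"
    and col: "\<And>i. i < Suc n \<Longrightarrow> A $$ (0, 0) dvd A $$ (i, 0)"
    and row: "\<And>j. j < Suc n \<Longrightarrow> A $$ (0, 0) dvd A $$ (0, j)"
  obtains E where "E \<in> carrier_mat n n"
    "unimodular_equiv (Suc n) A
      (four_block_mat (A $$ (0, 0) \<cdot>\<^sub>m 1\<^sub>m 1) (0\<^sub>m 1 n) (0\<^sub>m n 1) E)"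
proof -
  define g where "g = A $$ (0, 0)"
  define r where "r = mat 1 n (\<lambda>(i, j). A $$ (0, Suc j) div g)"
  define c where "c = mat n 1 (\<lambda>(i, j). A $$ (Suc i, 0) div g)"
  define D where "D = mat n n (\<lambda>(i, j). A $$ (Suc i, Suc j))"
  define G where "G = g \<cdot>\<^sub>m (1\<^sub>m 1 :: int mat)"
  define P where "P = four_block_mat (1\<^sub>m 1) (0\<^sub>m 1 n) (- c) (1\<^sub>m n)"
  define P' where "P' = four_block_mat (1\<^sub>m 1) (0\<^sub>m 1 n) c (1\<^sub>m n)"
  define Q where "Q = four_block_mat (1\<^sub>m 1) (- r) (0\<^sub>m n 1) (1\<^sub>m n)"
  define Q' where "Q' = four_block_mat (1\<^sub>m 1) r (0\<^sub>m n 1) (1\<^sub>m n)"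
  define E where "E = D - c * (g \<cdot>\<^sub>m r)"
  have [simp]: "r \<in> carrier_mat 1 n" "c \<in> carrier_mat n 1" "D \<in> carrier_mat n n"
    "G \<in> carrier_mat 1 1" "E \<in> carrier_mat n n" "- r \<in> carrier_mat 1 n" "- c \<in> carrier_mat n 1"
    unfolding r_def c_def D_def G_def E_def by auto
  have [simp]: "P \<in> carrier_mat (Suc n) (Suc n)" "P' \<in> carrier_mat (Suc n) (Suc n)"
    "Q \<in> carrier_mat (Suc n) (Suc n)" "Q' \<in> carrier_mat (Suc n) (Suc n)"
    unfolding P_def P'_def Q_def Q'_def
    using four_block_carrier_mat[of "1\<^sub>m 1" 1 1 "1\<^sub>m n" n n] by auto
  have one: "four_block_mat (1\<^sub>m 1) (0\<^sub>m 1 n) (0\<^sub>m n 1) (1\<^sub>m n) = (1\<^sub>m (Suc n) :: int mat)"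
    using four_block_one_mat[of 1 n] by simp
  have dims[simp]: "dim_row r = 1" "dim_col r = n" "dim_row c = n" "dim_col c = 1"
    by (auto simp: r_def c_def)
  have inv: "P * P' = 1\<^sub>m (Suc n)" "P' * P = 1\<^sub>m (Suc n)" "Q * Q' = 1\<^sub>m (Suc n)" "Q' * Q = 1\<^sub>m (Suc n)"
    unfolding P_def P'_def Q_def Q'_def one[symmetric]
    by (subst mult_four_block_mat[of _ 1 1 _ n _ n _ _ 1 _ n]; force)+
  have A_eq: "A = four_block_mat G (g \<cdot>\<^sub>m r) (g \<cdot>\<^sub>m c) D"
  proof (rule eq_matI)
    fix i j assume "i < dim_row (four_block_mat G (g \<cdot>\<^sub>m r) (g \<cdot>\<^sub>m c) D)"
      "j < dim_col (four_block_mat G (g \<cdot>\<^sub>m r) (g \<cdot>\<^sub>m c) D)"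
    then show "A $$ (i, j) = four_block_mat G (g \<cdot>\<^sub>m r) (g \<cdot>\<^sub>m c) D $$ (i, j)"
      using row[of j] col[of i] by (cases i; cases j) (auto simp: G_def D_def r_def c_def g_def)
  qed (use A in \<open>auto simp: G_def D_def\<close>)
  have "P * A = four_block_mat G (g \<cdot>\<^sub>m r) (0\<^sub>m n 1) E"
    unfolding P_def A_eq
    by (subst mult_four_block_mat[of _ 1 1 _ n _ n _ _ 1 _ n])
      (auto simp: E_def G_def D_def c_def intro!: cong_four_block_mat)
  then have "P * A * Q = four_block_mat G (g \<cdot>\<^sub>m r) (0\<^sub>m n 1) E * Q" by simp
  also have "\<dots> = four_block_mat G (0\<^sub>m 1 n) (0\<^sub>m n 1) E"
    unfolding Q_def
    by (subst mult_four_block_mat[of _ 1 1 _ n _ n _ _ 1 _ n])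
      (auto simp: E_def D_def c_def r_def G_def intro!: cong_four_block_mat)
  finally have "P * A * Q = four_block_mat G (0\<^sub>m 1 n) (0\<^sub>m n 1) E" .
  then have "unimodular_equiv (Suc n) A (four_block_mat G (0\<^sub>m 1 n) (0\<^sub>m n 1) E)"
    using inv A by (intro unimodular_equivI[of _ _ P Q])
      (auto intro: invertible_matI[of _ "Suc n" P'] invertible_matI[of _ "Suc n" Q'])
  then show thesis using that[of E] by (auto simp: G_def g_def)
qed

section \<open>Existence of the Smith normal form\<close>

text \<open>Unimodular operations cannot destroy a common divisor of the entries. This is what makes the
corner entry split off in one step divide all diagonal entries found later.\<close>

lemma mat_mult_entry_dvd:
  fixes g :: int
  assumes A: "A \<in> carrier_mat n n" and P: "P \<in> carrier_mat n n" and Q: "Q \<in> carrier_mat n n"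
    and dvd: "\<And>i j. i < n \<Longrightarrow> j < n \<Longrightarrow> g dvd A $$ (i, j)" and ij: "i < n" "j < n"
  shows "g dvd (P * A * Q) $$ (i, j)"
proof -
  define M where "M = P * A"
  have M: "M \<in> carrier_mat n n" using A P by (simp add: M_def)
  have dvd_M: "g dvd M $$ (i, k)" if "k < n" for k
    using that A P ij by (auto simp: M_def scalar_prod_def intro!: dvd_sum dvd_mult dvd)
  have "(M * Q) $$ (i, j) = (\<Sum>k = 0..<n. M $$ (i, k) * Q $$ (k, j))"
    using M Q ij by (simp add: scalar_prod_def)
  also have "g dvd \<dots>" by (intro dvd_sum dvd_mult2 dvd_M) auto
  finally show ?thesis by (simp add: M_def)
qed

lemma invertible_block_diag:
  fixes P Q :: "int mat"
  assumes P: "P \<in> carrier_mat n n" "invertible_mat P"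
    and Q: "Q \<in> carrier_mat m m" "invertible_mat Q"
  shows "invertible_mat (four_block_mat P (0\<^sub>m n m) (0\<^sub>m m n) Q)"
proof -
  obtain P' where P': "P' \<in> carrier_mat n n" "P * P' = 1\<^sub>m n" "P' * P = 1\<^sub>m n"
    using invertible_matE[OF P(2,1)] .
  obtain Q' where Q': "Q' \<in> carrier_mat m m" "Q * Q' = 1\<^sub>m m" "Q' * Q = 1\<^sub>m m"
    using invertible_matE[OF Q(2,1)] .
  let ?F = "\<lambda>P Q. four_block_mat P (0\<^sub>m n m) (0\<^sub>m m n) Q :: int mat"
  show ?thesis
  proof (rule invertible_matI)
    show "?F P Q \<in> carrier_mat (n + m) (n + m)" "?F P' Q' \<in> carrier_mat (n + m) (n + m)"
      using P Q P' Q' by auto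
    show "?F P Q * ?F P' Q' = 1\<^sub>m (n + m)" "?F P' Q' * ?F P Q = 1\<^sub>m (n + m)"
      using P Q P' Q' by (simp_all add: mult_four_block_mat[of _ n n _ m _ m _ _ n _ m])
  qed
qed

lemma unimodular_equiv_corner:
  assumes "unimodular_equiv n A B"
  shows "unimodular_equiv (Suc n)
    (four_block_mat (g \<cdot>\<^sub>m 1\<^sub>m 1) (0\<^sub>m 1 n) (0\<^sub>m n 1) A)
    (four_block_mat (g \<cdot>\<^sub>m 1\<^sub>m 1) (0\<^sub>m 1 n) (0\<^sub>m n 1) B)"
proof -
  obtain P Q where PQ: "P \<in> carrier_mat n n" "Q \<in> carrier_mat n n"
      "invertible_mat P" "invertible_mat Q" "B = P * A * Q" and A: "A \<in> carrier_mat n n"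
    using assms unfolding unimodular_equiv_def by blast
  let ?F = "\<lambda>G P. four_block_mat G (0\<^sub>m 1 n) (0\<^sub>m n 1) P :: int mat"
  have mult: "?F G R * ?F G' R' = ?F (G * G') (R * R')"
    if "R \<in> carrier_mat n n" "R' \<in> carrier_mat n n" "G \<in> carrier_mat 1 1" "G' \<in> carrier_mat 1 1" for R R' G G'
    using that by (subst mult_four_block_mat[of _ 1 1 _ n _ n _ _ 1 _ n]) auto
  have carrier: "?F G R \<in> carrier_mat (Suc n) (Suc n)"
    if "R \<in> carrier_mat n n" "G \<in> carrier_mat 1 1" for R G
    using four_block_carrier_mat[OF that(2,1)] by simp
  have "?F (g \<cdot>\<^sub>m 1\<^sub>m 1) B = ?F (1\<^sub>m 1) P * ?F (g \<cdot>\<^sub>m 1\<^sub>m 1) A * ?F (1\<^sub>m 1) Q"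
    using mult[OF PQ(1) A, of "1\<^sub>m 1" "g \<cdot>\<^sub>m 1\<^sub>m 1"]
      mult[OF _ PQ(2), of "P * A" "g \<cdot>\<^sub>m 1\<^sub>m 1" "1\<^sub>m 1"] PQ A by simp
  then show ?thesis
    using PQ A
    by (intro unimodular_equivI[of _ _ "?F (1\<^sub>m 1) P" "?F (1\<^sub>m 1) Q"] carrier
        invertible_block_diag invertible_one_mat) simp_all
qed

definition smith_form :: "nat \<Rightarrow> int mat \<Rightarrow> bool" where
  "smith_form n S \<longleftrightarrow> diagonal_mat S \<and> (\<forall>i<n. 0 \<le> S $$ (i, i)) \<and>
    (\<forall>i. Suc i < n \<longrightarrow> S $$ (i, i) dvd S $$ (Suc i, Suc i))"

lemma smith_form_zero: "smith_form n (0\<^sub>m n n)"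
  unfolding smith_form_def diagonal_mat_def by auto

lemma smith_form_corner:
  assumes S: "smith_form n S" "S \<in> carrier_mat n n"
    and g: "0 \<le> g" "\<And>i. i < n \<Longrightarrow> g dvd S $$ (i, i)"
  shows "smith_form (Suc n) (four_block_mat (g \<cdot>\<^sub>m 1\<^sub>m 1) (0\<^sub>m 1 n) (0\<^sub>m n 1) S)" (is "smith_form _ ?T")
proof -
  have ix: "?T $$ (i, j) = (if i = 0 \<and> j = 0 then g else if i = 0 \<or> j = 0 then 0 else S $$ (i - 1, j - 1))"
    if "i < Suc n" "j < Suc n" for i j using that S(2) by auto
  have "diagonal_mat ?T"
    unfolding diagonal_mat_def
  proof (intro allI impI)
    fix i j assume ij: "i < dim_row ?T" "j < dim_col ?T" "i \<noteq> j"
    then have "i < Suc n" "j < Suc n" using S(2) by auto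
    then show "?T $$ (i, j) = 0"
      using ix ij(3) S unfolding smith_form_def diagonal_mat_def by (cases i; cases j) auto
  qed
  moreover have "0 \<le> ?T $$ (i, i)" if "i < Suc n" for i
    using ix[OF that that] g(1) S(1) that unfolding smith_form_def by (cases i) auto
  moreover have "?T $$ (i, i) dvd ?T $$ (Suc i, Suc i)" if "Suc i < Suc n" for i
    using ix[of i i] ix[of "Suc i" "Suc i"] that g(2)[of 0] S(1) unfolding smith_form_def
    by (cases i) auto
  ultimately show ?thesis unfolding smith_form_def by blast
qed

text \<open>Euclidean division: if the corner entry is as small as any nonzero entry of any equivalent
matrix, then the remainder of a column entry, which a row operation produces, has to vanish.\<close>

lemma minimal_corner_divides_column:
  fixes A :: "int mat"
  assumes A: "A \<in> carrier_mat n n" and pos: "0 < A $$ (0, 0)"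
    and minimal: "\<And>B i j. unimodular_equiv n A B \<Longrightarrow> i < n \<Longrightarrow> j < n \<Longrightarrow> B $$ (i, j) \<noteq> 0 \<Longrightarrow>
      A $$ (0, 0) \<le> \<bar>B $$ (i, j)\<bar>"
    and i: "i < n"
  shows "A $$ (0, 0) dvd A $$ (i, 0)"
proof (cases "i = 0")
  case False
  let ?g = "A $$ (0, 0)"
  let ?B = "addrow (- (A $$ (i, 0) div ?g)) i 0 A"
  have "?B $$ (i, 0) = A $$ (i, 0) mod ?g"
    using A i by (simp add: minus_div_mult_eq_mod[symmetric] algebra_simps)
  moreover have "unimodular_equiv n A ?B"
    using A i False by (intro unimodular_equiv_addrow) auto
  ultimately have "A $$ (i, 0) mod ?g = 0"
    using minimal[of ?B i 0] i pos pos_mod_bound[OF pos, of "A $$ (i, 0)"] pos_mod_sign[OF pos, of "A $$ (i, 0)"]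
    by fastforce
  then show ?thesis by auto
qed simp

lemma minimal_corner_divides_row:
  fixes A :: "int mat"
  assumes A: "A \<in> carrier_mat n n" and pos: "0 < A $$ (0, 0)"
    and minimal: "\<And>B i j. unimodular_equiv n A B \<Longrightarrow> i < n \<Longrightarrow> j < n \<Longrightarrow> B $$ (i, j) \<noteq> 0 \<Longrightarrow>
      A $$ (0, 0) \<le> \<bar>B $$ (i, j)\<bar>"
    and j: "j < n"
  shows "A $$ (0, 0) dvd A $$ (0, j)"
proof -
  have "A\<^sup>T $$ (0, 0) dvd A\<^sup>T $$ (j, 0)"
  proof (rule minimal_corner_divides_column)
    fix B i k
    assume B: "unimodular_equiv n A\<^sup>T B" "i < n" "k < n" "B $$ (i, k) \<noteq> 0"
    have "unimodular_equiv n A B\<^sup>T" using unimodular_equiv_transpose[OF B(1)] by simp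
    then show "A\<^sup>T $$ (0, 0) \<le> \<bar>B $$ (i, k)\<bar>"
      using minimal[of "B\<^sup>T" k i] B unimodular_equiv_carrier(2)[OF B(1)] A by auto
  qed (use A pos j in auto)
  then show ?thesis using A j by auto
qed

text \<open>After clearing, a minimal corner divides the remaining block too: adding a lower row to the
first one leaves the corner unchanged and puts the entries of that row next to it, where the
divisibility of the first row applies.\<close>

lemma minimal_corner_reduction:
  fixes A :: "int mat"
  assumes A: "A \<in> carrier_mat (Suc n) (Suc n)" and pos: "0 < A $$ (0, 0)"
    and minimal: "\<And>B i j. unimodular_equiv (Suc n) A B \<Longrightarrow> i < Suc n \<Longrightarrow> j < Suc n \<Longrightarrow> B $$ (i, j) \<noteq> 0 \<Longrightarrow>
      A $$ (0, 0) \<le> \<bar>B $$ (i, j)\<bar>"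
  obtains E where "E \<in> carrier_mat n n"
    "\<And>i j. i < n \<Longrightarrow> j < n \<Longrightarrow> A $$ (0, 0) dvd E $$ (i, j)"
    "unimodular_equiv (Suc n) A
      (four_block_mat (A $$ (0, 0) \<cdot>\<^sub>m 1\<^sub>m 1) (0\<^sub>m 1 n) (0\<^sub>m n 1) E)"
proof -
  let ?g = "A $$ (0, 0)"
  obtain E where E: "E \<in> carrier_mat n n"
    and equiv: "unimodular_equiv (Suc n) A (four_block_mat (?g \<cdot>\<^sub>m 1\<^sub>m 1) (0\<^sub>m 1 n) (0\<^sub>m n 1) E)"
      (is "unimodular_equiv _ _ ?M")
  proof (rule clear_first_row_and_column[OF A])
    show "?g dvd A $$ (i, 0)" if "i < Suc n" for i
      by (rule minimal_corner_divides_column[OF A pos minimal that])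
    show "?g dvd A $$ (0, j)" if "j < Suc n" for j
      by (rule minimal_corner_divides_row[OF A pos minimal that])
  qed
  have M: "?M \<in> carrier_mat (Suc n) (Suc n)" using equiv unimodular_equiv_carrier by blast
  have "?g dvd E $$ (i, j)" if ij: "i < n" "j < n" for i j
  proof -
    let ?R = "addrow 1 0 (Suc i) ?M"
    have MR: "unimodular_equiv (Suc n) ?M ?R"
      using M ij by (intro unimodular_equiv_addrow) auto
    have R: "?R \<in> carrier_mat (Suc n) (Suc n)" using M by simp
    have corner: "?R $$ (0, 0) = ?g" and right: "?R $$ (0, Suc j) = E $$ (i, j)"
      using M E ij by auto
    have "?R $$ (0, 0) dvd ?R $$ (0, Suc j)"
    proof (rule minimal_corner_divides_row[OF R])
      show "?R $$ (0, 0) \<le> \<bar>B $$ (k, l)\<bar>"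
        if "unimodular_equiv (Suc n) ?R B" "k < Suc n" "l < Suc n" "B $$ (k, l) \<noteq> 0" for B k l
        unfolding corner
        using minimal that unimodular_equiv_trans[OF equiv unimodular_equiv_trans[OF MR that(1)]] by blast
    qed (use pos corner ij in auto)
    then show ?thesis unfolding corner right .
  qed
  then show thesis using that E equiv by blast
qed

text \<open>Any entry can be moved to the corner by unimodular operations, so a smallest nonzero entry of
the whole equivalence class can be found there, and its sign can be chosen.\<close>

lemma minimal_corner_exists:
  fixes A :: "int mat"
  assumes A: "A \<in> carrier_mat n n" and nz: "A \<noteq> 0\<^sub>m n n"
  obtains B where "unimodular_equiv n A B" "0 < B $$ (0, 0)"
    "\<And>C i j. unimodular_equiv n B C \<Longrightarrow> i < n \<Longrightarrow> j < n \<Longrightarrow> C $$ (i, j) \<noteq> 0 \<Longrightarrow>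
      B $$ (0, 0) \<le> \<bar>C $$ (i, j)\<bar>"
proof -
  \<comment> \<open>The smallest absolute value of a nonzero entry over all matrices equivalent to \<open>A\<close>.\<close>
  let ?P = "\<lambda>k. 0 < k \<and> (\<exists>B i j. unimodular_equiv n A B \<and> i < n \<and> j < n \<and> nat \<bar>B $$ (i, j)\<bar> = k)"
  obtain i j where "i < n" "j < n" "A $$ (i, j) \<noteq> 0"
  proof -
    have "\<exists>i j. i < n \<and> j < n \<and> A $$ (i, j) \<noteq> 0"
      using nz A by (metis carrier_matD eq_matI index_zero_mat)
    then show thesis using that by blast
  qed
  then have "?P (nat \<bar>A $$ (i, j)\<bar>)"
    using unimodular_equiv_refl[OF A] by auto
  then have P: "?P (LEAST k. ?P k)" by (rule LeastI)
  define k where "k = (LEAST k. ?P k)"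
  obtain B0 i j where B0: "unimodular_equiv n A B0" "i < n" "j < n" "nat \<bar>B0 $$ (i, j)\<bar> = k" and k: "0 < k"
    using P unfolding k_def by blast
  have least: "k \<le> nat \<bar>C $$ (i, j)\<bar>"
    if "unimodular_equiv n A C" "i < n" "j < n" "C $$ (i, j) \<noteq> 0" for C i j
    unfolding k_def by (rule Least_le) (use that in auto)
  obtain B1 where B1: "unimodular_equiv n B0 B1" "B1 $$ (0, 0) = B0 $$ (i, j)"
    using unimodular_equiv_move_to_corner[OF _ B0(2,3)] unimodular_equiv_carrier(2)[OF B0(1)] by metis
  have B1_carrier: "B1 \<in> carrier_mat n n" using unimodular_equiv_carrier(2)[OF B1(1)] .
  have n: "0 < n" using B0 by auto
  obtain B where B: "unimodular_equiv n B1 B" "B $$ (0, 0) = int k"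
  proof (cases "0 < B1 $$ (0, 0)")
    case True
    then show thesis using that[of B1] unimodular_equiv_refl[OF B1_carrier] B1 B0 by auto
  next
    case False
    then show thesis
      using that[of "- B1"] unimodular_equiv_uminus[OF B1_carrier] B1 B0 k n B1_carrier by auto
  qed
  have AB: "unimodular_equiv n A B" using B0 B1 B unimodular_equiv_trans by blast
  show thesis
  proof (rule that[OF AB])
    show "B $$ (0, 0) \<le> \<bar>C $$ (i, j)\<bar>"
      if "unimodular_equiv n B C" "i < n" "j < n" "C $$ (i, j) \<noteq> 0" for C i j
      using least[of C i j] that unimodular_equiv_trans[OF AB that(1)] B(2) by auto
  qed (use B k in auto)
qed

text \<open>Induction on the size: make the corner minimal, split it off, and treat the remaining block. The
corner divides that block, hence also the diagonal entries which the induction produces.\<close>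

lemma smith_form_exists:
  assumes "A \<in> carrier_mat n n"
  obtains S where "unimodular_equiv n A S" "smith_form n S"
proof -
  have "\<exists>S. unimodular_equiv n A S \<and> smith_form n S"
    using assms
  proof (induction n arbitrary: A)
    case 0
    then show ?case
      using unimodular_equiv_refl[OF 0] by (auto simp: smith_form_def diagonal_mat_def)
  next
    case (Suc n)
    show ?case
    proof (cases "A = 0\<^sub>m (Suc n) (Suc n)")
      case True
      then show ?thesis using unimodular_equiv_refl[OF Suc.prems] smith_form_zero by blast
    next
      case False
      obtain B where B: "unimodular_equiv (Suc n) A B" "0 < B $$ (0, 0)"
        and minimal: "\<And>C i j. unimodular_equiv (Suc n) B C \<Longrightarrow> i < Suc n \<Longrightarrow> j < Suc n \<Longrightarrow>
          C $$ (i, j) \<noteq> 0 \<Longrightarrow> B $$ (0, 0) \<le> \<bar>C $$ (i, j)\<bar>"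
        using minimal_corner_exists[OF Suc.prems False] by blast
      let ?g = "B $$ (0, 0)"
      let ?F = "\<lambda>E. four_block_mat (?g \<cdot>\<^sub>m 1\<^sub>m 1) (0\<^sub>m 1 n) (0\<^sub>m n 1) E"
      obtain E where E: "E \<in> carrier_mat n n" "\<And>i j. i < n \<Longrightarrow> j < n \<Longrightarrow> ?g dvd E $$ (i, j)"
        "unimodular_equiv (Suc n) B (?F E)"
        using minimal_corner_reduction[OF unimodular_equiv_carrier(2)[OF B(1)] B(2) minimal] by blast
      obtain S where S: "unimodular_equiv n E S" "smith_form n S"
        using Suc.IH[OF E(1)] by blast
      have "?g dvd S $$ (i, i)" if "i < n" for i
        using S(1) mat_mult_entry_dvd[OF E(1) _ _ E(2)] that unfolding unimodular_equiv_def by blast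
      then have "smith_form (Suc n) (?F S)"
        using S B(2) unimodular_equiv_carrier(2)[OF S(1)] by (intro smith_form_corner) auto
      moreover have "unimodular_equiv (Suc n) A (?F S)"
        using B(1) E(3) unimodular_equiv_corner[OF S(1)] unimodular_equiv_trans by blast
      ultimately show ?thesis by blast
    qed
  qed
  then show thesis using that by blast
qed

lemma has_invariant_factorsI:
  assumes "unimodular_equiv n A S" "smith_form n S" "diag_mat S = ds"
  shows "has_invariant_factors A ds"
  using assms unimodular_equiv_carrier[OF assms(1)]
  unfolding has_invariant_factors_def smith_normal_form_of_def unimodular_equiv_def smith_form_def
  by blast

section \<open>Unitary divisors\<close>

lemma upward_closed_subset_lessThan:
  fixes U :: "nat set"
  assumes "U \<subseteq> {..<n}" and up: "\<And>i j. i \<in> U \<Longrightarrow> i \<le> j \<Longrightarrow> j < n \<Longrightarrow> j \<in> U"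
  shows "U = {n - card U..<n}"
proof -
  have fin: "finite U" using assms(1) finite_subset by blast
  have "U \<subseteq> {n - card U..<n}"
  proof
    fix i assume i: "i \<in> U"
    have "{i..<n} \<subseteq> U" using up[OF i] by auto
    from card_mono[OF fin this] show "i \<in> {n - card U..<n}" using i assms(1) by auto
  qed
  moreover have "card {n - card U..<n} = card U"
    using card_mono[OF _ assms(1)] by auto
  ultimately show ?thesis by (intro card_subset_eq) auto
qed

text \<open>At each prime \<open>p\<close> dividing \<open>N\<close>, coprimality forces the \<open>p\<close>-adic valuation of \<open>d i\<close> to be
zero or that of \<open>N\<close>, so the product formula says that \<open>p\<close> divides exactly half of the \<open>d i\<close>. As
the \<open>d i\<close> form a divisibility chain, this half is the upper half, the same for every \<open>p\<close>. Hence
the lower half has no prime divisor, and neither do the complements \<open>e i\<close> of the upper half.\<close>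

lemma unitary_divisor_chain_half:
  fixes d e :: "nat \<Rightarrow> int" and N :: int
  assumes N: "1 < N"
    and nonneg: "\<And>i. i < n \<Longrightarrow> 0 \<le> d i"
    and compl: "\<And>i. i < n \<Longrightarrow> d i * e i = N"
    and unitary: "\<And>i. i < n \<Longrightarrow> coprime (d i) (e i)"
    and chain: "\<And>i. Suc i < n \<Longrightarrow> d i dvd d (Suc i)"
    and prod: "(\<Prod>i<n. d i)\<^sup>2 = N ^ n"
  obtains m where "n = 2 * m" "\<And>i. i < m \<Longrightarrow> d i = 1" "\<And>i. m \<le> i \<Longrightarrow> i < n \<Longrightarrow> d i = N"
proof -
  have nz: "d i \<noteq> 0" "e i \<noteq> 0" if "i < n" for i using compl[OF that] N by auto
  have dvd_le: "d i dvd d j" if "i \<le> j" "j < n" for i j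
    using that
  proof (induction j rule: dec_induct)
    case (step k)
    then show ?case using chain[of k] dvd_trans by (meson Suc_lessD)
  qed auto
  have half: "2 * card {i \<in> {..<n}. p dvd d i} = n" if p: "prime p" "p dvd N" for p
  proof -
    define v where "v = multiplicity p N"
    have v: "v > 0" unfolding v_def using p N by (auto simp: prime_multiplicity_gt_zero_iff)
    have mult: "multiplicity p (d i) = (if p dvd d i then v else 0)" if i: "i < n" for i
    proof (cases "p dvd d i")
      case True
      then have "\<not> p dvd e i" using unitary[OF i] p(1) coprime_common_divisor not_prime_unit by blast
      then have "multiplicity p (d i * e i) = multiplicity p (d i)"
        using nz[OF i] p(1)
        by (subst prime_elem_multiplicity_mult_distrib) (auto simp: not_dvd_imp_multiplicity_0)
      then show ?thesis using True compl[OF i] by (simp add: v_def)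
    qed (simp add: not_dvd_imp_multiplicity_0)
    have "n * v = multiplicity p (N ^ n)"
      unfolding v_def using p N by (subst prime_elem_multiplicity_power_distrib) auto
    also have "\<dots> = 2 * multiplicity p (\<Prod>i<n. d i)"
      unfolding prod[symmetric] using p nz by (subst prime_elem_multiplicity_power_distrib) auto
    also have "multiplicity p (\<Prod>i<n. d i) = (\<Sum>i<n. multiplicity p (d i))"
      using p nz by (subst prime_elem_multiplicity_prod_distrib) auto
    also have "\<dots> = (\<Sum>i<n. if p dvd d i then v else 0)" using mult by (intro sum.cong) auto
    also have "\<dots> = card {i \<in> {..<n}. p dvd d i} * v" by (subst sum.inter_filter[symmetric]) auto
    finally show ?thesis using v by simp
  qed
  obtain p0 where p0: "prime p0" "p0 dvd N" using N prime_divisor_exists[of N] by auto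
  define m where "m = card {i \<in> {..<n}. p0 dvd d i}"
  have n: "n = 2 * m" using half[OF p0] m_def by simp
  have upper: "{i \<in> {..<n}. p dvd d i} = {m..<n}" if "prime p" "p dvd N" for p
  proof -
    let ?U = "{i \<in> {..<n}. p dvd d i}"
    have "?U = {n - card ?U..<n}"
    proof (rule upward_closed_subset_lessThan)
      show "j \<in> ?U" if "i \<in> ?U" "i \<le> j" "j < n" for i j
        using that dvd_trans[OF _ dvd_le[OF that(2,3)], of p] by simp
    qed auto
    moreover have "card ?U = m" using half[OF that] n by simp
    ultimately show ?thesis using n by simp
  qed
  have "d i = 1" if "i < m" for i
  proof (rule ccontr)
    have i: "i < n" using that n by simp
    assume "d i \<noteq> 1"
    then have "\<not> is_unit (d i)" using nonneg[OF i] by auto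
    then obtain p where p: "prime p" "p dvd d i" using prime_divisor_exists[of "d i"] nz[OF i] by auto
    then have "p dvd N" using compl[OF i] by (metis dvd_mult2)
    moreover have "i \<in> {i \<in> {..<n}. p dvd d i}" using p(2) i by simp
    ultimately have "i \<in> {m..<n}" using upper[OF p(1)] by blast
    then show False using that by simp
  qed
  moreover have "d i = N" if "m \<le> i" "i < n" for i
  proof -
    have i: "i < n" by fact
    have "0 < d i * e i" using compl[OF i] N by simp
    then have "0 < e i" using nonneg[OF i] by (simp add: zero_less_mult_iff)
    have "is_unit (e i)"
    proof (rule ccontr)
      assume "\<not> is_unit (e i)"
      then obtain p where p: "prime p" "p dvd e i" using prime_divisor_exists[of "e i"] nz[OF i] by auto
      then have "p dvd N" using compl[OF i] by (metis dvd_mult)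
      moreover have "i \<in> {m..<n}" using that by simp
      ultimately have "p dvd d i" using upper[OF p(1)] by blast
      then show False using p unitary[OF i] coprime_common_divisor not_prime_unit by blast
    qed
    then have "e i = 1" using \<open>0 < e i\<close> by simp
    then show ?thesis using compl[OF i] by simp
  qed
  ultimately show thesis using that n by blast
qed

text \<open>The greatest common divisor divides \<open>2\<close>, and if it were \<open>2\<close> then the product would be a multiple
of \<open>4\<close>. This is where it matters that the number of colors is not divisible by \<open>4\<close>.\<close>

lemma coprime_if_combination_two:
  fixes d e a b :: int
  assumes "d * a + b * e = 2" "\<not> 4 dvd d * e"
  shows "coprime d e"
proof -
  have "gcd d e dvd d * a + b * e" by simp
  then have "gcd d e dvd 2" using assms(1) by simp
  then have "gcd d e \<le> 2" "gcd d e \<noteq> 0" by (auto dest: zdvd_imp_le)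
  moreover have "0 \<le> gcd d e" by simp
  moreover have "gcd d e \<noteq> 2"
  proof
    assume "gcd d e = 2"
    then have "2 dvd d" "2 dvd e" by (metis gcd_dvd1, metis gcd_dvd2)
    then have "2 * 2 dvd d * e" by (rule mult_dvd_mono)
    then show False using assms(2) by simp
  qed
  ultimately have "gcd d e = 1" by linarith
  then show ?thesis by (simp add: coprime_iff_gcd_eq_1)
qed

section \<open>Integer matrices with Clifford relations\<close>

text \<open>Let \<open>S = P * X * Q\<close> be the Smith normal form with diagonal \<open>d\<close> and let \<open>T\<close> be the conjugate
\<open>Q' * X\<^sup>T * P'\<close> of the transpose. The first relation gives \<open>S * T = N\<close>, so \<open>T\<close> is diagonal with the
complementary divisors \<open>e i = N / d i\<close>. The second relation becomes \<open>S * A + C * T = 2\<close>, whose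
diagonal entries bound the common divisors of \<open>d i\<close> and \<open>e i\<close>. Determinants give the product
formula, and the chain lemma above finishes. For \<open>N = 1\<close> all divisors are \<open>1\<close> and the size may be
odd, which is why the last conclusion is a disjunction. The inverse pairs are part of the
conclusion because the Laplacian is transformed by all four matrices.\<close>

lemma clifford_normal_form:
  fixes X Y :: "int mat" and N :: int
  assumes X: "X \<in> carrier_mat n n" and Y: "Y \<in> carrier_mat n n"
    and XX: "X * X\<^sup>T = N \<cdot>\<^sub>m 1\<^sub>m n" and XY: "X * Y\<^sup>T + Y * X\<^sup>T = 2 \<cdot>\<^sub>m 1\<^sub>m n"
    and N: "1 \<le> N" "\<not> 4 dvd N"
  obtains m P P' Q Q' where
    "P \<in> carrier_mat n n" "P' \<in> carrier_mat n n" "P * P' = 1\<^sub>m n" "P' * P = 1\<^sub>m n"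
    "Q \<in> carrier_mat n n" "Q' \<in> carrier_mat n n" "Q * Q' = 1\<^sub>m n" "Q' * Q = 1\<^sub>m n"
    "P * X * Q = mat_diag n (\<lambda>i. if i < m then 1 else N)"
    "Q' * X\<^sup>T * P' = mat_diag n (\<lambda>i. if i < m then N else 1)"
    "N = 1 \<or> n = 2 * m"
proof -
  obtain S where S: "unimodular_equiv n X S" "smith_form n S"
    using smith_form_exists[OF X] .
  obtain P Q where P: "P \<in> carrier_mat n n" "invertible_mat P"
      and Q: "Q \<in> carrier_mat n n" "invertible_mat Q" and S_eq: "S = P * X * Q"
    using S(1) unfolding unimodular_equiv_def by blast
  obtain P' where P': "P' \<in> carrier_mat n n" "P * P' = 1\<^sub>m n" "P' * P = 1\<^sub>m n"
    using invertible_matE[OF P(2,1)] .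
  obtain Q' where Q': "Q' \<in> carrier_mat n n" "Q * Q' = 1\<^sub>m n" "Q' * Q = 1\<^sub>m n"
    using invertible_matE[OF Q(2,1)] .
  note assoc = assoc_mult_mat[of _ n n _ n _ n]
  have XT: "X\<^sup>T \<in> carrier_mat n n" and YT: "Y\<^sup>T \<in> carrier_mat n n" using X Y by auto
  define d where "d i = S $$ (i, i)" for i
  define T where "T = Q' * X\<^sup>T * P'"
  define e where "e i = T $$ (i, i)" for i
  define A where "A = Q' * Y\<^sup>T * P'"
  define C where "C = P * Y * Q"
  have carriers: "S \<in> carrier_mat n n" "T \<in> carrier_mat n n" "A \<in> carrier_mat n n" "C \<in> carrier_mat n n"
    using P Q P' Q' X Y by (auto simp: S_eq T_def A_def C_def)
  have S_diag: "S = mat_diag n d"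
    using S(2) carriers(1) by (intro eq_matI) (auto simp: smith_form_def diagonal_mat_def mat_diag_def d_def)
  have "S * T = P * (X * X\<^sup>T) * P'"
    using P Q P' Q' X XT
    by (simp add: S_eq T_def assoc mult_inverse_cancel_left[OF Q'(1) Q(1) Q'(2), of _ n])
  also have "\<dots> = N \<cdot>\<^sub>m 1\<^sub>m n"
    using P P' mult_smult_distrib[of P n n "1\<^sub>m n" n N] mult_smult_assoc_mat[of P n n P' n N] by (simp add: XX)
  finally have ST: "S * T = N \<cdot>\<^sub>m 1\<^sub>m n" .
  have ST_entry: "d i * T $$ (i, j) = (if i = j then N else 0)" if "i < n" "j < n" for i j
    using arg_cong[OF ST, of "\<lambda>M. M $$ (i, j)"] that carriers(2)
    unfolding S_diag by (simp add: mat_diag_mult_left[of _ n n])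
  have compl: "d i * e i = N" if "i < n" for i using ST_entry[OF that that] by (simp add: e_def)
  have d_pos: "0 < d i" if "i < n" for i
    using compl[OF that] N(1) S(2) that unfolding smith_form_def d_def[symmetric]
    by (metis le_less mult_zero_left not_one_le_zero)
  have T_diag: "T = mat_diag n e"
  proof (rule eq_matI)
    fix i j assume "i < dim_row (mat_diag n e)" "j < dim_col (mat_diag n e)"
    then have ij: "i < n" "j < n" by (auto simp: mat_diag_def)
    then show "T $$ (i, j) = mat_diag n e $$ (i, j)"
      using ST_entry[OF ij] d_pos[of i] by (auto simp: mat_diag_def e_def)
  qed (use carriers in \<open>auto simp: mat_diag_def\<close>)
  have "S * A + C * T = P * (X * Y\<^sup>T) * P' + P * (Y * X\<^sup>T) * P'"
    using P Q P' Q' X Y XT YT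
    by (simp add: S_eq T_def A_def C_def assoc mult_inverse_cancel_left[OF Q'(1) Q(1) Q'(2), of _ n])
  also have "\<dots> = P * (X * Y\<^sup>T + Y * X\<^sup>T) * P'"
    using P P' X Y XT YT
    by (simp add: mult_add_distrib_mat[of _ n n _ n] add_mult_distrib_mat[of _ n n _ _ n])
  also have "\<dots> = 2 \<cdot>\<^sub>m 1\<^sub>m n" 
    using P P' mult_smult_distrib[of P n n "1\<^sub>m n" n 2] mult_smult_assoc_mat[of P n n P' n 2] by (simp add: XY)
  finally have two: "S * A + C * T = 2 \<cdot>\<^sub>m 1\<^sub>m n" .
  have unitary: "coprime (d i) (e i)" if i: "i < n" for i
  proof (rule coprime_if_combination_two)
    have "(S * A) $$ (i, i) = d i * A $$ (i, i)"
      using carriers(3) i unfolding S_diag by (simp add: mat_diag_mult_left[of _ n n])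
    moreover have "(C * T) $$ (i, i) = C $$ (i, i) * e i"
      using carriers(4) i unfolding T_diag by (simp add: mat_diag_mult_right[of _ n n])
    moreover have "(S * A + C * T) $$ (i, i) = (S * A) $$ (i, i) + (C * T) $$ (i, i)"
      using carriers i by simp
    ultimately show "d i * A $$ (i, i) + C $$ (i, i) * e i = 2" using two i by simp
    show "\<not> 4 dvd d i * e i" using compl[OF i] N(2) by simp
  qed
  have det_sq: "(det R)\<^sup>2 = 1" if "R \<in> carrier_mat n n" "R' \<in> carrier_mat n n" "R * R' = 1\<^sub>m n" for R R' :: "int mat"
  proof -
    have "det R * det R' = 1" using det_mult[OF that(1,2)] that(3) by simp
    then have "det R = 1 \<or> det R = -1" by (auto simp: zmult_eq_1_iff)
    then show ?thesis by auto
  qed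
  \<comment> \<open>Unimodular factors change the determinant at most by a sign, so it is compared in squares.\<close>
  have "(det X)\<^sup>2 = det (X * X\<^sup>T)"
    using det_mult[OF X XT] det_transpose[OF X] by (simp add: power2_eq_square)
  then have "(det X)\<^sup>2 = N ^ n" unfolding XX by simp
  moreover have "det S = det P * det X * det Q"
    unfolding S_eq using P Q X by (simp add: det_mult[of _ n])
  ultimately have "(det S)\<^sup>2 = N ^ n"
    using det_sq[OF P(1) P'(1,2)] det_sq[OF Q(1) Q'(1,2)] by (simp add: power_mult_distrib)
  moreover have "det S = (\<Prod>i<n. d i)"
    using det_upper_triangular[of S n] carriers(1) unfolding S_diag
    by (auto simp: mat_diag_def prod_list_diag_prod atLeast0LessThan upper_triangular_def)
  ultimately have prod: "(\<Prod>i<n. d i)\<^sup>2 = N ^ n" by simp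
  obtain m where m: "N = 1 \<or> n = 2 * m" "\<And>i. i < n \<Longrightarrow> d i = (if i < m then 1 else N)"
  proof (cases "N = 1")
    case True
    have "d i = 1" if "i < n" for i
      using compl[OF that] d_pos[OF that] True by (auto simp: zmult_eq_1_iff)
    then show thesis using that[of n] True by simp
  next
    case False
    have "1 < N" using False N by simp
    have nonneg: "0 \<le> d i" if "i < n" for i using d_pos[OF that] by simp
    have chain: "d i dvd d (Suc i)" if "Suc i < n" for i
      using S(2) that unfolding smith_form_def d_def by blast
    obtain m where "n = 2 * m" "\<And>i. i < m \<Longrightarrow> d i = 1"
        "\<And>i. m \<le> i \<Longrightarrow> i < n \<Longrightarrow> d i = N"
      using unitary_divisor_chain_half[OF \<open>1 < N\<close> nonneg compl unitary chain prod] by blast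
    then show thesis using that[of m] by simp
  qed
  have "e i = (if i < m then N else 1)" if "i < n" for i
    using compl[OF that] m(2)[OF that] N by (auto split: if_splits)
  then have "Q' * X\<^sup>T * P' = mat_diag n (\<lambda>i. if i < m then N else 1)"
    using T_diag unfolding T_def by (auto simp: mat_diag_def)
  moreover have "P * X * Q = mat_diag n (\<lambda>i. if i < m then 1 else N)"
    using S_diag m(2) unfolding S_eq by (auto simp: mat_diag_def)
  ultimately show thesis
    using that[of P P' Q Q' m] P P' Q Q' m(1) by blast
qed

section \<open>The signed Laplacian\<close>

text \<open>Multiplying by the block-diagonal matrices with blocks \<open>P, Q'\<close> on the left and \<open>P', Q\<close> on the right
pairs inverses with each other at the scalar blocks. At the off-diagonal blocks it produces the
two products that \<open>clifford_normal_form\<close> makes diagonal at the same time.\<close>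

lemma signed_laplacian_equiv:
  fixes X :: "int mat"
  assumes X: "X \<in> carrier_mat n n"
    and P: "P \<in> carrier_mat n n" "P' \<in> carrier_mat n n" "P * P' = 1\<^sub>m n" "P' * P = 1\<^sub>m n"
    and Q: "Q \<in> carrier_mat n n" "Q' \<in> carrier_mat n n" "Q * Q' = 1\<^sub>m n" "Q' * Q = 1\<^sub>m n"
  shows "unimodular_equiv (n + n) (signed_laplacian k X)
    (four_block_mat (int k \<cdot>\<^sub>m 1\<^sub>m n) (- (P * X * Q)) (- (Q' * X\<^sup>T * P')) (int k \<cdot>\<^sub>m 1\<^sub>m n))"
proof -
  let ?F = "\<lambda>P Q. four_block_mat P (0\<^sub>m n n) (0\<^sub>m n n) Q :: int mat"
  have L: "signed_laplacian k X = four_block_mat (int k \<cdot>\<^sub>m 1\<^sub>m n) (- X) (- X\<^sup>T) (int k \<cdot>\<^sub>m 1\<^sub>m n)"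
    using X by (simp add: signed_laplacian_def)
  have XT: "X\<^sup>T \<in> carrier_mat n n" using X by simp
  have carriers: "- (P * X * Q) \<in> carrier_mat n n" "- (Q' * X\<^sup>T * P') \<in> carrier_mat n n"
    using X P Q by auto
  have "?F P Q' * signed_laplacian k X = four_block_mat (int k \<cdot>\<^sub>m P) (- (P * X)) (- (Q' * X\<^sup>T)) (int k \<cdot>\<^sub>m Q')"
    unfolding L using P Q X XT
    by (subst mult_four_block_mat[of _ n n _ n _ n _ _ n _ n]) (auto simp: mult_smult_distrib[of _ n n _ n])
  then have "?F P Q' * signed_laplacian k X * ?F P' Q =
      four_block_mat (int k \<cdot>\<^sub>m 1\<^sub>m n) (- (P * X * Q)) (- (Q' * X\<^sup>T * P')) (int k \<cdot>\<^sub>m 1\<^sub>m n)"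
    using P Q X XT
    by (simp add: mult_four_block_mat[of _ n n _ n _ n _ _ n _ n] mult_smult_assoc_mat[of _ n n _ n]
        left_add_zero_mat[OF carriers(1)] right_add_zero_mat[OF carriers(2)] del: assoc_mult_mat)
  moreover have "invertible_mat (?F P Q')" "invertible_mat (?F P' Q)"
    using P Q by (auto intro!: invertible_block_diag intro: invertible_matI)
  ultimately show ?thesis
    using P Q X XT by (intro unimodular_equivI[of _ _ "?F P Q'" "?F P' Q"]) (auto simp: L)
qed

text \<open>Up to a permutation of the rows and columns this is the direct sum of the \<open>2\<close> by \<open>2\<close> matrices with
rows \<open>(a i, b i)\<close> and \<open>(c i, e i)\<close>. Multiplication and inversion therefore happen separately at
each index.\<close>

definition diag_blocks ::
    "nat \<Rightarrow> (nat \<Rightarrow> int) \<Rightarrow> (nat \<Rightarrow> int) \<Rightarrow> (nat \<Rightarrow> int) \<Rightarrow> (nat \<Rightarrow> int) \<Rightarrow> int mat" where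
  "diag_blocks n a b c e = four_block_mat (mat_diag n a) (mat_diag n b) (mat_diag n c) (mat_diag n e)"

lemma diag_blocks_carrier: "diag_blocks n a b c e \<in> carrier_mat (n + n) (n + n)"
  unfolding diag_blocks_def by (rule four_block_carrier_mat) auto

lemma diag_blocks_mult:
  "diag_blocks n a b c e * diag_blocks n a' b' c' e' =
    diag_blocks n (\<lambda>i. a i * a' i + b i * c' i) (\<lambda>i. a i * b' i + b i * e' i)
      (\<lambda>i. c i * a' i + e i * c' i) (\<lambda>i. c i * b' i + e i * e' i)"
proof -
  have add: "mat_diag n f + mat_diag n g = mat_diag n (\<lambda>i. f i + g i)" for f g :: "nat \<Rightarrow> int"
    by (auto simp: mat_diag_def)
  show ?thesis
    unfolding diag_blocks_def
    by (subst mult_four_block_mat[of _ n n _ n _ n _ _ n _ n]) (simp_all add: add)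
qed

lemma diag_blocks_cong:
  assumes "\<And>i. i < n \<Longrightarrow> a i = a' i" "\<And>i. i < n \<Longrightarrow> b i = b' i"
    "\<And>i. i < n \<Longrightarrow> c i = c' i" "\<And>i. i < n \<Longrightarrow> e i = e' i"
  shows "diag_blocks n a b c e = diag_blocks n a' b' c' e'"
proof -
  have "mat_diag n f = mat_diag n g" if "\<And>i. i < n \<Longrightarrow> f i = g i" for f g :: "nat \<Rightarrow> int"
    using that by (intro eq_matI) (auto simp: mat_diag_def)
  from this[of a a'] this[of b b'] this[of c c'] this[of e e'] show ?thesis
    using assms by (simp add: diag_blocks_def)
qed

lemma diag_blocks_one: "diag_blocks n (\<lambda>_. 1) (\<lambda>_. 0) (\<lambda>_. 0) (\<lambda>_. 1) = 1\<^sub>m (n + n)"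
proof -
  have "mat_diag n (\<lambda>_. 0) = (0\<^sub>m n n :: int mat)" by (auto simp: mat_diag_def)
  then show ?thesis unfolding diag_blocks_def by simp
qed

lemma invertible_diag_blocks:
  assumes "\<And>i. i < n \<Longrightarrow> a i * e i - b i * c i = 1"
  shows "invertible_mat (diag_blocks n a b c e)"
proof (rule invertible_matI)
  let ?I = "diag_blocks n e (\<lambda>i. - b i) (\<lambda>i. - c i) a"
  show "diag_blocks n a b c e * ?I = 1\<^sub>m (n + n)" "?I * diag_blocks n a b c e = 1\<^sub>m (n + n)"
    unfolding diag_blocks_mult diag_blocks_one[symmetric]
    using assms by (auto intro!: diag_blocks_cong simp: algebra_simps)
qed (rule diag_blocks_carrier)+

text \<open>Each \<open>2\<close> by \<open>2\<close> summand has a unit among its entries and determinant \<open>k * k - k\<close>. The unit sits in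
the upper right corner when \<open>i < m\<close> and in the lower left corner otherwise, whence the two
sets of elementary operations.\<close>

lemma split_laplacian_normal_form:
  fixes k :: int
  shows "unimodular_equiv (n + n)
    (diag_blocks n (\<lambda>_. k) (\<lambda>i. - (if i < m then 1 else k)) (\<lambda>i. - (if i < m then k else 1)) (\<lambda>_. k))
    (diag_blocks n (\<lambda>_. 1) (\<lambda>_. 0) (\<lambda>_. 0) (\<lambda>_. k * (k - 1)))"
    (is "unimodular_equiv _ ?M ?S")
proof (rule unimodular_equivI)
  let ?U = "diag_blocks n (\<lambda>i. if i < m then 1 else 0) (\<lambda>i. if i < m then 0 else -1)
      (\<lambda>i. if i < m then k else 1) (\<lambda>i. if i < m then 1 else k)"
  let ?W = "diag_blocks n (\<lambda>i. if i < m then 0 else 1) (\<lambda>i. if i < m then 1 else k)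
      (\<lambda>i. if i < m then -1 else 0) (\<lambda>i. if i < m then k else 1)"
  show "invertible_mat ?U" "invertible_mat ?W" by (rule invertible_diag_blocks; simp)+
  show "?S = ?U * ?M * ?W"
    unfolding diag_blocks_mult by (rule diag_blocks_cong) (auto simp: algebra_simps)
qed (rule diag_blocks_carrier)+

lemma smith_form_mat_diag:
  assumes "\<And>i. i < n \<Longrightarrow> 0 \<le> d i" "\<And>i. Suc i < n \<Longrightarrow> d i dvd d (Suc i)"
  shows "smith_form n (mat_diag n d)"
  using assms unfolding smith_form_def diagonal_mat_def mat_diag_def by auto

lemma diag_mat_mat_diag: "diag_mat (mat_diag n d) = map d [0..<n]"
  unfolding diag_mat_def mat_diag_def by auto

lemma laplacian_form_eq_mat_diag:
  "diag_blocks n (\<lambda>_. 1) (\<lambda>_. 0) (\<lambda>_. 0) (\<lambda>_. c) = mat_diag (n + n) (\<lambda>i. if i < n then 1 else c)"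
  unfolding diag_blocks_def by (rule eq_matI) (auto simp: mat_diag_def)

lemma map_two_values: "map (\<lambda>i. if i < m then x else y) [0..<m + n] = replicate m x @ replicate n y"
  by (rule nth_equalityI) (auto simp: nth_append)

lemma clifford_invariant_factors:
  fixes X Y :: "int mat" and N :: nat
  assumes X: "X \<in> carrier_mat n n" and Y: "Y \<in> carrier_mat n n"
    and XX: "X * X\<^sup>T = int N \<cdot>\<^sub>m 1\<^sub>m n" and XY: "X * Y\<^sup>T + Y * X\<^sup>T = 2 \<cdot>\<^sub>m 1\<^sub>m n"
    and N: "1 \<le> N" "\<not> 4 dvd N"
  shows "has_invariant_factors X
      (if N = 1 then replicate n 1 else replicate (n div 2) 1 @ replicate (n div 2) (int N))"
    and "has_invariant_factors (signed_laplacian N X)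
      (replicate n 1 @ replicate n (int N * (int N - 1)))"
proof -
  have N': "1 \<le> int N" "\<not> 4 dvd int N" using N by (auto simp: int_dvd_int_iff[of 4, simplified])
  obtain m P P' Q Q' where
    P: "P \<in> carrier_mat n n" "P' \<in> carrier_mat n n" "P * P' = 1\<^sub>m n" "P' * P = 1\<^sub>m n" and
    Q: "Q \<in> carrier_mat n n" "Q' \<in> carrier_mat n n" "Q * Q' = 1\<^sub>m n" "Q' * Q = 1\<^sub>m n" and
    S: "P * X * Q = mat_diag n (\<lambda>i. if i < m then 1 else int N)" and
    T: "Q' * X\<^sup>T * P' = mat_diag n (\<lambda>i. if i < m then int N else 1)" and
    m: "int N = 1 \<or> n = 2 * m"
    using clifford_normal_form[OF X Y XX XY N'] .
  have "unimodular_equiv n X (mat_diag n (\<lambda>i. if i < m then 1 else int N))"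
    unfolding S[symmetric]
    by (rule unimodular_equivI[OF X P(1) Q(1) invertible_matI[OF P] invertible_matI[OF Q] refl])
  moreover have "smith_form n (mat_diag n (\<lambda>i. if i < m then 1 else int N))"
    by (rule smith_form_mat_diag) auto
  moreover have "diag_mat (mat_diag n (\<lambda>i. if i < m then 1 else int N)) =
      (if N = 1 then replicate n 1 else replicate (n div 2) 1 @ replicate (n div 2) (int N))"
  proof (cases "N = 1")
    case True
    then have "(\<lambda>i. if i < m then 1 else int N) = (\<lambda>_. 1)" by auto
    then show ?thesis using True by (simp add: diag_mat_mat_diag map_replicate_const)
  next
    case False
    then show ?thesis using m map_two_values[of m 1 "int N" m] by (simp add: diag_mat_mat_diag mult_2)
  qed
  ultimately show "has_invariant_factors X
      (if N = 1 then replicate n 1 else replicate (n div 2) 1 @ replicate (n div 2) (int N))"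
    by (rule has_invariant_factorsI)
  have "int N \<cdot>\<^sub>m 1\<^sub>m n = mat_diag n (\<lambda>_. int N)" "- mat_diag n f = mat_diag n (\<lambda>i. - f i)" for f :: "nat \<Rightarrow> int"
    by (auto simp: mat_diag_def)
  then have "unimodular_equiv (n + n) (signed_laplacian N X)
      (diag_blocks n (\<lambda>_. int N) (\<lambda>i. - (if i < m then 1 else int N))
        (\<lambda>i. - (if i < m then int N else 1)) (\<lambda>_. int N))"
    using signed_laplacian_equiv[OF X P Q, of N] unfolding S T diag_blocks_def by simp
  then have "unimodular_equiv (n + n) (signed_laplacian N X)
      (mat_diag (n + n) (\<lambda>i. if i < n then 1 else int N * (int N - 1)))"
    unfolding laplacian_form_eq_mat_diag[symmetric]
    by (rule unimodular_equiv_trans[OF _ split_laplacian_normal_form])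
  moreover have "smith_form (n + n) (mat_diag (n + n) (\<lambda>i. if i < n then 1 else int N * (int N - 1)))"
    using N' by (intro smith_form_mat_diag) auto
  moreover have "diag_mat (mat_diag (n + n) (\<lambda>i. if i < n then 1 else int N * (int N - 1))) =
      replicate n 1 @ replicate n (int N * (int N - 1))"
    unfolding diag_mat_mat_diag by (rule map_two_values)
  ultimately show "has_invariant_factors (signed_laplacian N X)
      (replicate n 1 @ replicate n (int N * (int N - 1)))"
    by (rule has_invariant_factorsI)
qed

section \<open>Clifford relations of an Adinkra\<close>

lemma four_cycle_two_edges_at_vertex:
  assumes "four_cycle C" "{v, x} \<in> C" "{v, y} \<in> C" "x \<noteq> y"
  obtains t where "distinct [v, x, t, y]" "C = {{v, x}, {x, t}, {t, y}, {y, v}}"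
proof -
  obtain a b c d where abcd: "distinct [a, b, c, d]" "C = {{a, b}, {b, c}, {c, d}, {d, a}}"
    using assms(1) unfolding four_cycle_def by blast
  \<comment> \<open>The vertex \<open>v\<close> may be any of the four, in either direction around the cycle.\<close>
  have "v = a \<and> {x, y} = {b, d} \<or> v = b \<and> {x, y} = {a, c} \<or>
      v = c \<and> {x, y} = {b, d} \<or> v = d \<and> {x, y} = {a, c}"
    using assms(2-4) abcd by (auto simp: doubleton_eq_iff)
  then consider "v = a" "x = b" "y = d" | "v = a" "x = d" "y = b"
    | "v = b" "x = a" "y = c" | "v = b" "x = c" "y = a"
    | "v = c" "x = b" "y = d" | "v = c" "x = d" "y = b"
    | "v = d" "x = a" "y = c" | "v = d" "x = c" "y = a"
    by (auto simp: doubleton_eq_iff)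
  then show thesis
  proof cases
    case 1 then show thesis using abcd by (intro that[of c]) auto next
    case 2 then show thesis using abcd by (intro that[of c]) auto next
    case 3 then show thesis using abcd by (intro that[of d]) auto next
    case 4 then show thesis using abcd by (intro that[of d]) auto next
    case 5 then show thesis using abcd by (intro that[of a]) auto next
    case 6 then show thesis using abcd by (intro that[of a]) auto next
    case 7 then show thesis using abcd by (intro that[of b]) auto next
    case 8 then show thesis using abcd by (intro that[of b]) auto
  qed
qed

lemma prod_four_signs_odd:
  fixes \<mu> :: "'e \<Rightarrow> int"
  assumes "e1 \<noteq> e2" "e1 \<noteq> e3" "e1 \<noteq> e4" "e2 \<noteq> e3" "e2 \<noteq> e4" "e3 \<noteq> e4"
    and "\<And>e. e \<in> {e1, e2, e3, e4} \<Longrightarrow> \<mu> e = 1 \<or> \<mu> e = -1"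
    and "odd (card {e \<in> {e1, e2, e3, e4}. \<mu> e = -1})"
  shows "\<mu> e1 * \<mu> e2 * \<mu> e3 * \<mu> e4 = -1"
proof -
  have "(-1) ^ card {e \<in> S. \<mu> e = -1} = (\<Prod>e\<in>S. \<mu> e)"
    if "finite S" "S \<subseteq> {e1, e2, e3, e4}" for S
    using that
  proof (induction S)
    case (insert x S)
    have "\<mu> x = 1 \<or> \<mu> x = -1" using insert.prems assms(7) by auto
    then show ?case
    proof
      assume x: "\<mu> x = 1"
      then have "{e \<in> insert x S. \<mu> e = -1} = {e \<in> S. \<mu> e = -1}" by auto
      then show ?thesis using insert x by simp
    next
      assume x: "\<mu> x = -1"
      then have "{e \<in> insert x S. \<mu> e = -1} = insert x {e \<in> S. \<mu> e = -1}" by auto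
      then show ?thesis using insert x by simp
    qed
  qed simp
  from this[of "{e1, e2, e3, e4}"] assms(8)
  have "(\<Prod>e\<in>{e1, e2, e3, e4}. \<mu> e) = -1" by simp
  then show ?thesis using assms(1-6) by (simp add: mult.assoc)
qed

context adinkra
begin

text \<open>Colors act as fixed-point-free involutions on the vertices.\<close>

definition nbr :: "nat \<Rightarrow> 'v \<Rightarrow> 'v" where
  "nbr c v = (THE w. {v, w} \<in> E \<and> color {v, w} = c)"

lemma edge_in_V: "{v, w} \<in> E \<Longrightarrow> v \<in> V \<and> w \<in> V"
  using simple[of "{v, w}"] by auto

lemma nbr_unique:
  assumes "{v, w} \<in> E" "{v, w'} \<in> E" "color {v, w} = color {v, w'}"
  shows "w = w'"
proof -
  have "v \<in> V" "color {v, w} < N" using assms(1) edge_in_V color_range by auto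
  then have "{v, w} = {v, w'}"
    using one_edge_of_each_color[of v "color {v, w}"] assms by (metis insertI1)
  then show ?thesis by (auto simp: doubleton_eq_iff)
qed

lemma nbr_edge:
  assumes "v \<in> V" "c < N"
  shows "{v, nbr c v} \<in> E \<and> color {v, nbr c v} = c"
proof -
  obtain e where e: "e \<in> E" "v \<in> e" "color e = c"
    using one_edge_of_each_color[OF assms] by blast
  then obtain w where w: "e = {v, w}"
    using bipartite[OF e(1)] by (metis empty_iff insert_commute insert_iff)
  show ?thesis unfolding nbr_def
    by (rule theI[of _ w]) (use e w nbr_unique in auto)
qed

lemma nbr_eqI:
  assumes "{v, w} \<in> E" "color {v, w} = c"
  shows "nbr c v = w"
proof -
  have "v \<in> V" "c < N" using assms edge_in_V color_range by auto
  then show ?thesis using nbr_edge[of v c] nbr_unique[of v w "nbr c v"] assms by auto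
qed

lemma nbr_in_V: "v \<in> V \<Longrightarrow> c < N \<Longrightarrow> nbr c v \<in> V"
  using nbr_edge edge_in_V by blast

lemma nbr_nbr: "v \<in> V \<Longrightarrow> c < N \<Longrightarrow> nbr c (nbr c v) = v"
  by (rule nbr_eqI) (use nbr_edge[of v c] in \<open>auto simp: insert_commute\<close>)

lemma nbr_boson_fermion:
  assumes "c < N"
  shows "v \<in> B \<Longrightarrow> nbr c v \<in> F" "v \<in> F \<Longrightarrow> nbr c v \<in> B"
proof -
  have "\<exists>b\<in>B. \<exists>f\<in>F. {v, nbr c v} = {b, f}" if "v \<in> V"
    using bipartite nbr_edge[OF that assms] by blast
  then show "v \<in> B \<Longrightarrow> nbr c v \<in> F" "v \<in> F \<Longrightarrow> nbr c v \<in> B"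
    using bipartition by (auto simp: doubleton_eq_iff)
qed

lemma bij_betw_nbr: "c < N \<Longrightarrow> bij_betw (nbr c) B F"
  by (rule bij_betw_byWitness[of _ "nbr c"])
    (use nbr_nbr nbr_boson_fermion bipartition(1) in auto)

lemma card_bosons_fermions: "card B = card V div 2" "card F = card V div 2"
proof -
  have "card B = card F" using bij_betw_same_card[OF bij_betw_nbr[of 0]] N_pos by simp
  moreover have "card V = card B + card F"
    using bipartition finite_vertices by (metis card_Un_disjoint finite_Un)
  ultimately show "card B = card V div 2" "card F = card V div 2" by auto
qed

definition sgn_nbr :: "nat \<Rightarrow> 'v \<Rightarrow> int" where
  "sgn_nbr c v = \<mu> {v, nbr c v}"

lemma sgn_nbr_cases: "v \<in> V \<Longrightarrow> c < N \<Longrightarrow> sgn_nbr c v = 1 \<or> sgn_nbr c v = -1"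
  unfolding sgn_nbr_def using signature nbr_edge by blast

lemma sgn_nbr_nbr: "v \<in> V \<Longrightarrow> c < N \<Longrightarrow> sgn_nbr c (nbr c v) = sgn_nbr c v"
  unfolding sgn_nbr_def by (simp add: nbr_nbr insert_commute)

text \<open>The two edges at \<open>v\<close> lie in one bicolor cycle, whose fourth vertex is reached from \<open>v\<close> by either
order of the two colors. An odd number of dashed edges means that the two paths to it carry
opposite signs, so the signed color involutions anticommute.\<close>

lemma nbr_anticommute:
  assumes v: "v \<in> V" and c: "c < N" and d: "d < N" and cd: "c \<noteq> d"
  shows "nbr d (nbr c v) = nbr c (nbr d v)"
    and "sgn_nbr c v * sgn_nbr d (nbr c v) = - (sgn_nbr d v * sgn_nbr c (nbr d v))"
proof -
  define x where "x = nbr c v"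
  define y where "y = nbr d v"
  have x: "{v, x} \<in> E" "color {v, x} = c" using nbr_edge[OF v c] by (auto simp: x_def)
  have y: "{v, y} \<in> E" "color {v, y} = d" using nbr_edge[OF v d] by (auto simp: y_def)
  have xy: "x \<noteq> y" using x y cd by auto
  let ?S = "bicolor_edges E color c d"
  obtain \<C> where \<C>: "\<And>C. C \<in> \<C> \<Longrightarrow> four_cycle C" "?S = \<Union>\<C>"
      and disj: "pairwise (\<lambda>C D. disjnt (\<Union>C) (\<Union>D)) \<C>"
    using bicolor[OF c d cd] unfolding disjoint_union_of_four_cycles_def by blast
  have "{v, x} \<in> ?S" "{v, y} \<in> ?S" using x y unfolding bicolor_edges_def by auto
  then obtain C D where CD: "C \<in> \<C>" "{v, x} \<in> C" "D \<in> \<C>" "{v, y} \<in> D"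
    unfolding \<C>(2) by blast
  have "C = D"
  proof (rule ccontr)
    assume "C \<noteq> D"
    then have "disjnt (\<Union>C) (\<Union>D)" using disj CD by (auto simp: pairwise_def)
    then show False using CD(2,4) by (auto simp: disjnt_def)
  qed
  then obtain t where t: "distinct [v, x, t, y]" "C = {{v, x}, {x, t}, {t, y}, {y, v}}"
    using four_cycle_two_edges_at_vertex[OF \<C>(1)[OF CD(1)] CD(2), of y] CD(4) xy by metis
  have CS: "C \<subseteq> ?S" using CD \<C>(2) by blast
  then have xt: "{x, t} \<in> E" "color {x, t} = c \<or> color {x, t} = d"
    and yt: "{y, t} \<in> E" "color {y, t} = c \<or> color {y, t} = d"
    using t(2) unfolding bicolor_edges_def by (auto simp: insert_commute)
  have "color {x, t} \<noteq> c" using nbr_unique[of x t v] xt(1) x t(1) by (auto simp: insert_commute)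
  then have xt': "color {x, t} = d" using xt by simp
  have "color {y, t} \<noteq> d" using nbr_unique[of y t v] yt(1) y t(1) by (auto simp: insert_commute)
  then have yt': "color {y, t} = c" using yt by simp
  have tx: "nbr d x = t" and ty: "nbr c y = t"
    using nbr_eqI xt(1) xt' yt(1) yt' by auto
  show "nbr d (nbr c v) = nbr c (nbr d v)" using tx ty by (simp add: x_def y_def)
  have odd: "odd (card {e \<in> {{v, x}, {x, t}, {t, y}, {y, v}}. \<mu> e = -1})"
    using odd_dashed[OF c d cd \<C>(1)[OF CD(1)] CS] t(2) by simp
  have "\<mu> {v, x} * \<mu> {x, t} * \<mu> {t, y} * \<mu> {y, v} = -1"
  proof (rule prod_four_signs_odd[OF _ _ _ _ _ _ _ odd])
    show "\<mu> e = 1 \<or> \<mu> e = -1" if "e \<in> {{v, x}, {x, t}, {t, y}, {y, v}}" for e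
      using that signature CS t(2) unfolding bicolor_edges_def by blast
  qed (use t(1) in \<open>auto simp: doubleton_eq_iff\<close>)
  then have "sgn_nbr c v * sgn_nbr d x * sgn_nbr c y * sgn_nbr d v = -1"
    unfolding sgn_nbr_def x_def[symmetric] y_def[symmetric] tx ty by (simp add: insert_commute)
  moreover have "sgn_nbr c y = 1 \<or> sgn_nbr c y = -1" "sgn_nbr d v = 1 \<or> sgn_nbr d v = -1"
    using sgn_nbr_cases c d v edge_in_V[OF y(1)] by auto
  ultimately show "sgn_nbr c v * sgn_nbr d (nbr c v) = - (sgn_nbr d v * sgn_nbr c (nbr d v))"
    unfolding x_def[symmetric] y_def[symmetric] by auto
qed

text \<open>The entries of the boson-fermion matrix of the edges of a single color.\<close>

definition color_entry :: "nat \<Rightarrow> 'v \<Rightarrow> 'v \<Rightarrow> int" where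
  "color_entry c b f = (if nbr c b = f then sgn_nbr c b else 0)"

lemma color_entry_mult_sum:
  assumes "b \<in> B" "b' \<in> B" "c < N" "d < N"
  shows "(\<Sum>f\<in>F. color_entry c b f * color_entry d b' f) =
    (if nbr d (nbr c b) = b' then sgn_nbr c b * sgn_nbr d (nbr c b) else 0)"
proof -
  have V: "b \<in> V" "b' \<in> V" "nbr c b \<in> V" using assms bipartition nbr_in_V by auto
  have fin: "finite F" using finite_vertices bipartition by (metis finite_Un)
  have "nbr d b' = nbr c b \<longleftrightarrow> nbr d (nbr c b) = b'"
    using nbr_nbr[OF V(2) assms(4)] nbr_nbr[OF V(3) assms(4)] by metis
  moreover have "(\<Sum>f\<in>F. color_entry c b f * color_entry d b' f) = color_entry c b (nbr c b) * color_entry d b' (nbr c b)"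
  proof -
    have "(\<Sum>f\<in>F. color_entry c b f * color_entry d b' f) =
        (\<Sum>f\<in>{nbr c b}. color_entry c b f * color_entry d b' f)"
      using fin nbr_boson_fermion(1)[OF assms(3,1)]
      by (intro sum.mono_neutral_right) (auto simp: color_entry_def)
    then show ?thesis by simp
  qed
  ultimately show ?thesis
    using sgn_nbr_nbr[OF V(3) assms(4)] by (auto simp: color_entry_def)
qed

text \<open>The matrices \<open>X\<^sub>c\<close> of the single colors satisfy the Clifford relations
\<open>X\<^sub>c X\<^sub>d\<^sup>T + X\<^sub>d X\<^sub>c\<^sup>T = 2 \<delta>\<^sub>c\<^sub>d\<close>: the terms are signed counts of the two-step paths from one boson to
another along the two colors, in either order.\<close>

lemma color_entry_clifford:
  assumes "b \<in> B" "b' \<in> B" "c < N" "d < N"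
  shows "(\<Sum>f\<in>F. color_entry c b f * color_entry d b' f)
       + (\<Sum>f\<in>F. color_entry d b f * color_entry c b' f) =
    (if c = d \<and> b = b' then 2 else 0)"
proof (cases "c = d")
  case True
  have "b \<in> V" using assms bipartition by auto
  then have "nbr d (nbr d b) = b" "sgn_nbr d b * sgn_nbr d (nbr d b) = 1"
    using nbr_nbr sgn_nbr_nbr sgn_nbr_cases assms by fastforce+
  then show ?thesis using color_entry_mult_sum[OF assms] True by auto
next
  case False
  have "b \<in> V" using assms bipartition by auto
  note ac = nbr_anticommute[OF this assms(3,4) False]
  show ?thesis
    using color_entry_mult_sum[OF assms] color_entry_mult_sum[OF assms(1,2,4,3)] False ac by simp
qed

definition entry :: "'v \<Rightarrow> 'v \<Rightarrow> int" where
  "entry b f = (if {b, f} \<in> E then \<mu> {b, f} else 0)"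

lemma entry_eq_sum:
  assumes "b \<in> B"
  shows "entry b f = (\<Sum>c<N. color_entry c b f)"
proof (cases "{b, f} \<in> E")
  case True
  have b: "b \<in> V" using assms bipartition by auto
  let ?k = "color {b, f}"
  have k: "?k < N" using color_range True by auto
  have "nbr c b = f \<longleftrightarrow> c = ?k" if "c < N" for c
    using nbr_edge[OF b that] nbr_eqI[OF True] by auto
  then have "(\<Sum>c<N. color_entry c b f) = (\<Sum>c<N. if c = ?k then sgn_nbr c b else 0)"
    by (intro sum.cong) (auto simp: color_entry_def)
  also have "\<dots> = sgn_nbr ?k b" using k by simp
  also have "\<dots> = \<mu> {b, f}" unfolding sgn_nbr_def using nbr_eqI[OF True refl] by simp
  finally show ?thesis using True by (simp add: entry_def)
next
  case False
  have b: "b \<in> V" using assms bipartition by auto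
  have "color_entry c b f = 0" if "c < N" for c
    using nbr_edge[OF b that] False by (auto simp: color_entry_def)
  then show ?thesis using False by (simp add: entry_def)
qed

text \<open>Summing the Clifford relations over one color: only the term in which both colors agree
survives.\<close>

lemma entry_color_anticommutator:
  assumes "b \<in> B" "b' \<in> B" "d < N"
  shows "(\<Sum>f\<in>F. entry b f * color_entry d b' f) + (\<Sum>f\<in>F. color_entry d b f * entry b' f)
    = (if b = b' then 2 else 0)"
proof -
  have "(\<Sum>f\<in>F. entry b f * color_entry d b' f) + (\<Sum>f\<in>F. color_entry d b f * entry b' f)
     = (\<Sum>c<N. (\<Sum>f\<in>F. color_entry c b f * color_entry d b' f)
           + (\<Sum>f\<in>F. color_entry d b f * color_entry c b' f))"
    using assms by (simp add: entry_eq_sum sum_distrib_left sum_distrib_right sum.distrib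
        sum.swap[of _ F "{..<N}"])
  also have "\<dots> = (\<Sum>c<N. if c = d then (if b = b' then 2 else 0) else 0)"
    using assms by (intro sum.cong) (auto simp: color_entry_clifford)
  also have "\<dots> = (if b = b' then 2 else 0)" using assms by simp
  finally show ?thesis .
qed

text \<open>Summing over the second color as well counts every product twice, hence the factor \<open>2\<close> in the
proof.\<close>

lemma entry_rows_orthogonal:
  assumes "b \<in> B" "b' \<in> B"
  shows "(\<Sum>f\<in>F. entry b f * entry b' f) = (if b = b' then int N else 0)"
proof -
  have "2 * (\<Sum>f\<in>F. entry b f * entry b' f) = (\<Sum>d<N.
      (\<Sum>f\<in>F. entry b f * color_entry d b' f) + (\<Sum>f\<in>F. color_entry d b f * entry b' f))"
  proof -
    have "(\<Sum>f\<in>F. entry b f * entry b' f) = (\<Sum>d<N. (\<Sum>f\<in>F. entry b f * color_entry d b' f))"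
      using assms(2) by (simp add: entry_eq_sum[of b'] sum_distrib_left sum.swap[of _ F "{..<N}"])
    moreover have "(\<Sum>f\<in>F. entry b f * entry b' f) = (\<Sum>d<N. (\<Sum>f\<in>F. color_entry d b f * entry b' f))"
      using assms(1) by (simp add: entry_eq_sum[of b] sum_distrib_right sum.swap[of _ F "{..<N}"])
    ultimately show ?thesis by (simp add: sum.distrib)
  qed
  also have "\<dots> = (\<Sum>d<N. if b = b' then 2 else 0)"
    using assms by (intro sum.cong) (auto simp: entry_color_anticommutator)
  also have "\<dots> = 2 * (if b = b' then int N else 0)" by simp
  finally show ?thesis by simp
qed

text \<open>The matrix \<open>Y\<close> of color \<open>0\<close> serves as the witness for the second relation; any color would do.\<close>

lemma boson_fermion_mat_clifford:
  assumes bs: "distinct bs" "set bs = B" and fs: "distinct fs" "set fs = F"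
  defines "n \<equiv> card V div 2" and "X \<equiv> boson_fermion_mat E \<mu> bs fs"
  defines "Y \<equiv> mat (length bs) (length fs) (\<lambda>(i, j). color_entry 0 (bs ! i) (fs ! j))"
  shows "X \<in> carrier_mat n n" "Y \<in> carrier_mat n n"
    "X * X\<^sup>T = int N \<cdot>\<^sub>m 1\<^sub>m n" "X * Y\<^sup>T + Y * X\<^sup>T = 2 \<cdot>\<^sub>m 1\<^sub>m n"
proof -
  have len: "length bs = n" "length fs = n"
    using card_bosons_fermions bs fs distinct_card unfolding n_def by metis+
  show X: "X \<in> carrier_mat n n" and Y: "Y \<in> carrier_mat n n"
    using len by (auto simp: X_def Y_def boson_fermion_mat_def)
  have X_ix: "X $$ (i, j) = entry (bs ! i) (fs ! j)" if "i < n" "j < n" for i j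
    using that len by (simp add: X_def boson_fermion_mat_def entry_def)
  have Y_ix: "Y $$ (i, j) = color_entry 0 (bs ! i) (fs ! j)" if "i < n" "j < n" for i j
    using that len by (simp add: Y_def)
  have bsB: "bs ! i \<in> B" if "i < n" for i using that len bs(2) nth_mem by metis
  have bs_eq: "bs ! i = bs ! j \<longleftrightarrow> i = j" if "i < n" "j < n" for i j
    using that len bs(1) nth_eq_iff_index_eq by metis
  have reindex: "(\<Sum>k<n. g (fs ! k)) = (\<Sum>f\<in>F. g f)" for g :: "'v \<Rightarrow> int"
  proof -
    have "bij_betw ((!) fs) {..<n} F" using bij_betw_nth[OF fs(1)] len fs(2) by auto
    then show ?thesis by (rule sum.reindex_bij_betw)
  qed
  have mult: "(A * C\<^sup>T) $$ (i, j) = (\<Sum>k<n. A $$ (i, k) * C $$ (j, k))"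
    if "A \<in> carrier_mat n n" "C \<in> carrier_mat n n" "i < n" "j < n" for A C :: "int mat" and i j
    using that by (simp add: scalar_prod_def atLeast0LessThan)
  have N0: "0 < N" using N_pos by simp
  show "X * X\<^sup>T = int N \<cdot>\<^sub>m 1\<^sub>m n"
  proof (rule eq_matI)
    fix i j assume "i < dim_row (int N \<cdot>\<^sub>m 1\<^sub>m n)" "j < dim_col (int N \<cdot>\<^sub>m 1\<^sub>m n)"
    then have ij: "i < n" "j < n" by auto
    have "(X * X\<^sup>T) $$ (i, j) = (\<Sum>k<n. entry (bs ! i) (fs ! k) * entry (bs ! j) (fs ! k))"
      using mult[OF X X ij] ij by (simp add: X_ix)
    also have "\<dots> = (if i = j then int N else 0)"
      using reindex[of "\<lambda>f. entry (bs ! i) f * entry (bs ! j) f"] entry_rows_orthogonal[of "bs ! i" "bs ! j"] bsB bs_eq ij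
      by simp
    finally show "(X * X\<^sup>T) $$ (i, j) = (int N \<cdot>\<^sub>m 1\<^sub>m n) $$ (i, j)" using ij by simp
  qed (use X in auto)
  show "X * Y\<^sup>T + Y * X\<^sup>T = 2 \<cdot>\<^sub>m 1\<^sub>m n"
  proof (rule eq_matI)
    fix i j assume "i < dim_row (2 \<cdot>\<^sub>m 1\<^sub>m n :: int mat)" "j < dim_col (2 \<cdot>\<^sub>m 1\<^sub>m n :: int mat)"
    then have ij: "i < n" "j < n" by auto
    have "(X * Y\<^sup>T + Y * X\<^sup>T) $$ (i, j) = (X * Y\<^sup>T) $$ (i, j) + (Y * X\<^sup>T) $$ (i, j)"
      using X Y ij by (intro index_add_mat) auto
    also have "\<dots> = (\<Sum>k<n. entry (bs ! i) (fs ! k) * color_entry 0 (bs ! j) (fs ! k))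
        + (\<Sum>k<n. color_entry 0 (bs ! i) (fs ! k) * entry (bs ! j) (fs ! k))"
      using mult[OF X Y ij] mult[OF Y X ij] ij by (simp add: X_ix Y_ix)
    also have "\<dots> = (if i = j then 2 else 0)"
      using reindex[of "\<lambda>f. entry (bs ! i) f * color_entry 0 (bs ! j) f"]
        reindex[of "\<lambda>f. color_entry 0 (bs ! i) f * entry (bs ! j) f"]
        entry_color_anticommutator[of "bs ! i" "bs ! j" 0] bsB bs_eq ij N0
      by simp
    finally show "(X * Y\<^sup>T + Y * X\<^sup>T) $$ (i, j) = (2 \<cdot>\<^sub>m 1\<^sub>m n) $$ (i, j)" using ij by simp
  qed (use X Y in auto)
qed

end

section \<open>The invariant factors\<close>

theorem corollary31:
  fixes V :: "'v set" and E :: "'v set set" and \<mu> :: "'v set \<Rightarrow> int"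
    and B F :: "'v set" and N :: nat and color :: "'v set \<Rightarrow> nat" and h :: "'v \<Rightarrow> int"
    and bs fs :: "'v list"
  assumes "adinkra V E \<mu> B F N color h"
    and "distinct bs" and "set bs = B"
    and "distinct fs" and "set fs = F"
    and "\<not> 4 dvd N"
  shows "has_invariant_factors (boson_fermion_mat E \<mu> bs fs)
      (if N = 1 then replicate (card V div 2) 1
       else replicate (card V div 4) 1 @ replicate (card V div 4) (int N)) \<and>
    has_invariant_factors (signed_laplacian N (boson_fermion_mat E \<mu> bs fs))
      (replicate (card V div 2) 1 @ replicate (card V div 2) (int N * (int N - 1)))"
proof -
  interpret adinkra V E \<mu> B F N color h by (rule assms(1))
  have "card V div 2 div 2 = card V div 4" by (simp add: div_mult2_eq[symmetric])
  then show ?thesis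
    using clifford_invariant_factors[OF boson_fermion_mat_clifford[OF assms(2-5)] N_pos assms(6)]
    by (simp only: simp_thms)
qed

end
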